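(* Let $\mathcal H$ be an infinite-dimensional complex Hilbert space, let $k$ be a positive integer, and let $\mathbf A=(A_1,\dots,A_m)$ be an $m$-tuple of bounded self-adjoint operators on $\mathcal H$. Let $\mathcal H_1$ be a (possibly non-separable) Hilbert space with an orthonormal basis $\{e_{\mu}:\mu=(\mu_1,\dots,\mu_m)\in W_{\rm ess}(\mathbf A)\}$ indexed by the points of the joint essential numerical range $W_{\rm ess}(\mathbf A)$. Let $(D_1,\dots,D_m)$ be the $m$-tuple of diagonal operators on $\mathcal H_1$ given by $D_je_\mu=\mu_je_\mu$, let $\mathcal H_0=\mathcal H_1\oplus\cdots\oplus\mathcal H_1$ be the orthogonal sum of $k$ copies of $\mathcal H_1$, let $I_k\otimes D_j=D_j\oplus\cdots\oplus D_j$ ($k$ copies) act on $\mathcal H_0$, and let $\tilde{\mathbf A}=(\tilde A_1,\dots,\tilde A_m)$, where $\tilde A_j=A_j\oplus(I_k\otimes D_j)$ acts on $\mathcal H\oplus\mathcal H_0$. Then: (1) For $\ell=1,\dots,k$, $W_\ell(I_k\otimes D_1,\dots,I_k\otimes D_m)=\ell\,W_{\rm ess}(\mathbf A)$. (2) The closure of $W_k(\mathbf A)$ equals $W_k(\tilde{\mathbf A})$. (3) The set $W_k(\mathbf A)$ is closed if and only if $W_k(\mathbf A)=W_k(\tilde{\mathbf A})$; equivalently, every element in $W_k(\mathbf A)$ has the form $(\operatorname{tr}(A_1P),\dots,\operatorname{tr}(A_mP))+(k-\operatorname{tr}P)\,\xi$ for a positive semidefinite contraction $P$ with rank at most $k$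 and $\xi\in W_{\rm ess}(\mathbf A)$.
   Context: For an $m$-tuple $\mathbf B=(B_1,\dots,B_m)$ of bounded operators on a complex Hilbert space $\mathcal K$ and a positive integer $k\le\dim\mathcal K$, the joint $k$-numerical range is $$W_k(\mathbf B)=\Big\{\Big(\sum_{\ell=1}^k\langle B_1x_\ell,x_\ell\rangle,\dots,\sum_{\ell=1}^k\langle B_mx_\ell,x_\ell\rangle\Big):\{x_1,\dots,x_k\}\subseteq\mathcal K\text{ orthonormal}\Big\}\subseteq\mathbb C^m,$$ and $W_1$ is written $W$. The joint essential numerical range of $\mathbf A$ is $W_{\rm ess}(\mathbf A)=\bigcap\{\overline{W(A_1+K_1,\dots,A_m+K_m)}:K_1,\dots,K_m\text{ compact operators on }\mathcal H\}$. For a set $S$ and a number $\ell$, $\ell S=\{\ell s:s\in S\}$. In (3), $P$ is an operator on $\mathcal H$.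
   Formalization: In (3), "every element in W_k(A) has the form …" is always true (P a rank-k projection), hence not equivalent to closedness (A = diag(1,1/2,1/3,…), k = 1); it is replaced by: W_k(A) equals the set of all points of that form. *)

theory Defs
  imports "HOL-Analysis.Analysis"
begin

text \<open>
  A complex inner product space is a real inner product space with a compatible complex scalar
  multiplication and a sesquilinear form (linear in the first argument) whose real part is the
  given real inner product.  Positive definiteness of the form and its relation to the norm are
  inherited from \<^class>\<open>real_inner\<close>, because \<open>cinner x x\<close> is real by conjugate symmetry.
\<close>

class complex_inner = real_inner +
  fixes scaleC :: "complex \<Rightarrow> 'a \<Rightarrow> 'a"  (infixr \<open>*\<^sub>C\<close> 75)
    and cinner :: "'a \<Rightarrow> 'a \<Rightarrow> complex"
  assumes scaleC_of_real: "complex_of_real r *\<^sub>C x = r *\<^sub>R x"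
    and scaleC_add_right: "c *\<^sub>C (x + y) = c *\<^sub>C x + c *\<^sub>C y"
    and scaleC_add_left: "(c + d) *\<^sub>C x = c *\<^sub>C x + d *\<^sub>C x"
    and scaleC_scaleC: "c *\<^sub>C d *\<^sub>C x = (c * d) *\<^sub>C x"
    and cinner_commute: "cinner x y = cnj (cinner y x)"
    and cinner_add_left: "cinner (x + y) z = cinner x z + cinner y z"
    and cinner_scaleC_left: "cinner (c *\<^sub>C x) y = c * cinner x y"
    and Re_cinner: "Re (cinner x y) = inner x y"

class complex_hilbert = complex_inner + complete_space

global_interpretation complex_vector: vector_space "scaleC :: complex \<Rightarrow> 'a \<Rightarrow> 'a::complex_inner"
  defines cspan = complex_vector.span
proof
  fix x :: 'a
  show "1 *\<^sub>C x = x"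
    using scaleC_of_real[of 1 x] by simp
qed (simp_all add: scaleC_add_right scaleC_add_left scaleC_scaleC)

instantiation prod :: (complex_inner, complex_inner) complex_inner
begin

definition "c *\<^sub>C x = (c *\<^sub>C fst x, c *\<^sub>C snd x)"
definition "cinner x y = cinner (fst x) (fst y) + cinner (snd x) (snd y)"

instance
proof
  fix x y :: "'a \<times> 'b"
  show "cinner x y = cnj (cinner y x)"
    unfolding cinner_prod_def complex_cnj_add
    using cinner_commute[of "fst x" "fst y"] cinner_commute[of "snd x" "snd y"] by simp
qed (simp_all add: scaleC_prod_def cinner_prod_def prod_eq_iff scaleC_of_real scaleC_add_right
      scaleC_add_left scaleC_scaleC cinner_add_left cinner_scaleC_left Re_cinner inner_prod_def
      algebra_simps)

end

instance prod :: (complex_hilbert, complex_hilbert) complex_hilbert ..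

instantiation vec :: (complex_inner, finite) complex_inner
begin

definition "c *\<^sub>C x = (\<chi> i. c *\<^sub>C (x $ i))"
definition "cinner x y = (\<Sum>i\<in>UNIV. cinner (x $ i) (y $ i))"

instance
proof
  fix x y :: "('a, 'b) vec"
  show "cinner x y = cnj (cinner y x)"
    unfolding cinner_vec_def cnj_sum
    by (intro sum.cong refl cinner_commute)
qed (simp_all add: scaleC_vec_def cinner_vec_def vec_eq_iff scaleC_of_real scaleC_add_right
      scaleC_add_left scaleC_scaleC cinner_add_left cinner_scaleC_left Re_cinner inner_vec_def
      sum.distrib sum_distrib_left)

end

instance vec :: (complex_hilbert, finite) complex_hilbert ..

definition infinite_dimensional :: "'a::complex_inner itself \<Rightarrow> bool" where
  "infinite_dimensional _ \<longleftrightarrow> \<not> (\<exists>B :: 'a set. finite B \<and> cspan B = UNIV)"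

definition bounded_clinear :: "('a::complex_inner \<Rightarrow> 'b::complex_inner) \<Rightarrow> bool" where
  "bounded_clinear T \<longleftrightarrow> bounded_linear T \<and> (\<forall>c x. T (c *\<^sub>C x) = c *\<^sub>C T x)"

definition selfadjoint :: "('a::complex_inner \<Rightarrow> 'a) \<Rightarrow> bool" where
  "selfadjoint T \<longleftrightarrow> bounded_clinear T \<and> (\<forall>x y. cinner (T x) y = cinner x (T y))"

definition compact_operator :: "('a::complex_inner \<Rightarrow> 'b::complex_inner) \<Rightarrow> bool" where
  "compact_operator K \<longleftrightarrow> bounded_clinear K \<and> compact (closure (K ` cball 0 1))"

definition orthonormal_on :: "'i set \<Rightarrow> ('i \<Rightarrow> 'a::complex_inner) \<Rightarrow> bool" where
  "orthonormal_on I x \<longleftrightarrow> (\<forall>i\<in>I. \<forall>j\<in>I. cinner (x i) (x j) = (if i = j then 1 else 0))"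

definition orthonormal_basis_on :: "'i set \<Rightarrow> ('i \<Rightarrow> 'a::complex_inner) \<Rightarrow> bool" where
  "orthonormal_basis_on I e \<longleftrightarrow> orthonormal_on I e \<and> closure (cspan (e ` I)) = UNIV"

definition joint_num_range ::
    "nat \<Rightarrow> ('m::finite \<Rightarrow> 'a::complex_inner \<Rightarrow> 'a) \<Rightarrow> (complex ^ 'm) set" where
  "joint_num_range k B =
    {\<chi> j. \<Sum>l<k. cinner (B j (x l)) (x l) | x :: nat \<Rightarrow> 'a. orthonormal_on {..<k} x}"

definition joint_ess_num_range ::
    "('m::finite \<Rightarrow> 'a::complex_inner \<Rightarrow> 'a) \<Rightarrow> (complex ^ 'm) set" where
  "joint_ess_num_range A =
    \<Inter> {closure (joint_num_range 1 (\<lambda>j x. A j x + K j x)) | K. \<forall>j. compact_operator (K j)}"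

text \<open>\<open>I\<^sub>k \<otimes> D\<close>, with \<open>k = CARD('k)\<close>, on the orthogonal sum \<open>'a ^ 'k\<close> of \<open>k\<close> copies of \<open>'a\<close>.\<close>

definition ampliation :: "('a \<Rightarrow> 'a) \<Rightarrow> 'a ^ 'k \<Rightarrow> 'a ^ ('k::finite)" where
  "ampliation D x = (\<chi> i. D (x $ i))"

text \<open>
  The sum of the diagonal entries in a chosen orthonormal basis; for trace class operators, in
  particular those of finite rank, it does not depend on the choice.
\<close>

definition op_trace :: "('a::complex_hilbert \<Rightarrow> 'a) \<Rightarrow> complex" where
  "op_trace T = (\<Sum>\<^sub>\<infinity>b\<in>(SOME B. orthonormal_basis_on B (\<lambda>b. b)). cinner (T b) b)"

definition positive_semidefinite :: "('a::complex_inner \<Rightarrow> 'a) \<Rightarrow> bool" where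
  "positive_semidefinite P \<longleftrightarrow> selfadjoint P \<and> (\<forall>x. 0 \<le> Re (cinner (P x) x))"

definition contraction :: "('a::complex_inner \<Rightarrow> 'a) \<Rightarrow> bool" where
  "contraction P \<longleftrightarrow> bounded_clinear P \<and> (\<forall>x. norm (P x) \<le> norm x)"

text \<open>Not phrased with the library's \<open>dim\<close>, which is \<open>0\<close> on infinite-dimensional spaces.\<close>

definition rank_at_most :: "nat \<Rightarrow> ('a::complex_inner \<Rightarrow> 'b::complex_inner) \<Rightarrow> bool" where
  "rank_at_most k P \<longleftrightarrow> (\<exists>B. finite B \<and> card B \<le> k \<and> range P \<subseteq> cspan B)"

end

theory Submission
  imports Defs "HOL-Library.Diagonal_Subsequence"
begin

text \<open>
  The essential numerical range consists of the points approximated by \<open>(\<langle>A\<^sub>j y, y\<rangle>)\<^sub>j\<close> on unit vectors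
  \<open>y\<close> orthogonal to any prescribed finite set; a separation argument against finite-rank
  perturbations gives the nontrivial inclusion, and this description makes convexity immediate.
  Both the closure of \<open>W\<^sub>k(A)\<close> and \<open>W\<^sub>k\<close> of the enlarged tuple are identified with the set of points
  \<open>\<Sum>\<^sub>l (\<langle>A\<^sub>j u\<^sub>l, u\<^sub>l\<rangle>)\<^sub>j + (k - \<Sum>\<^sub>l \<parallel>u\<^sub>l\<parallel>\<^sup>2) \<xi>\<close>, where \<open>\<xi>\<close> is in the essential range and the Gram matrix of
  \<open>u\<^sub>1, \<dots>, u\<^sub>k\<close> is at most the identity.  The \<open>u\<^sub>l\<close> arise as weak limits of orthonormal families, and
  as first components of orthonormal families in the enlarged space; conversely the defect of the
  Gram matrix is filled with almost invisible vectors realising \<open>\<xi>\<close>.  Writing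
  \<open>P = \<Sum>\<^sub>l u\<^sub>l u\<^sub>l\<^sup>*\<close> gives the trace form.
\<close>

section \<open>Complex inner product spaces\<close>

text \<open>The defect explains why exactly \<open>k\<close> copies appear. If \<open>G\<close> is
  the Gram matrix of the \<open>u l\<close>, then \<open>I - G\<close> is positive of size
  \<open>k\<close>, so it equals \<open>V V\<^sup>*\<close> for a square matrix \<open>V\<close>.
  Adding \<open>\<Sum>c<k. V l c *\<^sub>C y c\<close> to \<open>u l\<close> gives an orthonormal
  family whenever the \<open>y c\<close> are \<open>k\<close> orthonormal vectors orthogonal to
  every \<open>u l\<close>. In the enlarged space these are the copies of \<open>e \<xi>\<close>,
  where \<open>\<xi>\<close> is attained exactly; in the original space their values only come near
  \<open>\<xi>\<close>, and this costs a closure.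

  In the other direction the obstacle is that one \<open>\<xi>\<close> must absorb the remainders of
  \<open>k\<close> vectors at once, none of which need have a convergent value of its own. Hence
  nothing is chosen vector by vector: the summed remainders are tested against half-spaces, and
  convexity and closedness produce \<open>\<xi>\<close>. The engine is
  \<open>ess_range_support\<close>: a strict half-space bound on the essential range becomes a bound
  on the forms of all vectors orthogonal to some finite set. It also yields nonemptiness and the
  comparison with compact perturbations.\<close>

lemma mult_cnj_self: "z * cnj z = (complex_of_real (cmod z))\<^sup>2" "cnj z * z = (complex_of_real (cmod z))\<^sup>2"
  using complex_norm_square[of z] by (simp_all add: mult.commute)

lemma cinner_add_right: "cinner x (y + z) = cinner x y + cinner x (z::'a::complex_inner)"
  by (metis cinner_add_left cinner_commute complex_cnj_add)

lemma cinner_scaleC_right: "cinner x (c *\<^sub>C y) = cnj c * cinner x (y::'a::complex_inner)"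
  by (metis cinner_scaleC_left cinner_commute complex_cnj_mult)

lemma cinner_self: "cinner x x = complex_of_real ((norm (x::'a::complex_inner))\<^sup>2)"
proof -
  have "Im (cinner x x) = 0"
    using arg_cong[OF cinner_commute[of x x], of Im] by simp
  then show ?thesis
    by (simp add: complex_eq_iff Re_cinner dot_square_norm)
qed

lemma norm_scaleC [simp]: "norm (c *\<^sub>C x) = cmod c * norm (x::'a::complex_inner)"
proof -
  have "complex_of_real ((norm (c *\<^sub>C x))\<^sup>2) = (c * cnj c) * cinner x x"
    unfolding cinner_self[symmetric] cinner_scaleC_left cinner_scaleC_right by simp
  then have "complex_of_real ((norm (c *\<^sub>C x))\<^sup>2) = complex_of_real ((cmod c * norm x)\<^sup>2)"
    by (simp add: cinner_self mult_cnj_self power_mult_distrib)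
  then show ?thesis
    by (metis norm_ge_zero mult_nonneg_nonneg of_real_eq_iff power2_eq_imp_eq)
qed

lemma norm_cinner_le: "norm (cinner x y) \<le> norm x * norm (y::'a::complex_inner)"
proof (cases "cinner x y = 0")
  case False
  \<comment> \<open>This unimodular factor rotates the inner product onto the positive reals, so
    that the real Cauchy-Schwarz inequality bounds its modulus.\<close>
  define c where "c = cnj (cinner x y) / cmod (cinner x y)"
  have c: "cmod c = 1" "c * cinner x y = cmod (cinner x y)"
    using False by (simp_all add: c_def norm_divide mult_cnj_self power2_eq_square)
  have "cmod (cinner x y) = Re (cinner (c *\<^sub>C x) y)"
    by (simp add: cinner_scaleC_left c)
  also have "\<dots> \<le> norm (c *\<^sub>C x) * norm y"
    unfolding Re_cinner by (rule norm_cauchy_schwarz)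
  finally show ?thesis by (simp add: c)
qed simp

lemma bounded_bilinear_cinner: "bounded_bilinear (cinner :: 'a::complex_inner \<Rightarrow> 'a \<Rightarrow> complex)"
proof
  show "\<exists>K. \<forall>a b::'a. norm (cinner a b) \<le> norm a * norm b * K"
    using norm_cinner_le by (metis mult_1_right)
qed (simp_all add: cinner_add_left cinner_add_right cinner_scaleC_left cinner_scaleC_right scaleR_conv_of_real
    flip: scaleC_of_real)

lemmas cinner_simps [simp] =
  bounded_bilinear.zero_left[OF bounded_bilinear_cinner]
  bounded_bilinear.zero_right[OF bounded_bilinear_cinner]
lemmas cinner_diff_left = bounded_bilinear.diff_left[OF bounded_bilinear_cinner]
lemmas cinner_diff_right = bounded_bilinear.diff_right[OF bounded_bilinear_cinner]
lemmas cinner_sum_left = bounded_bilinear.sum_left[OF bounded_bilinear_cinner]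
lemmas cinner_sum_right = bounded_bilinear.sum_right[OF bounded_bilinear_cinner]
lemmas tendsto_cinner = bounded_bilinear.tendsto[OF bounded_bilinear_cinner]
lemmas bounded_linear_cinner_left = bounded_bilinear.bounded_linear_left[OF bounded_bilinear_cinner]

lemma continuous_on_cinner [continuous_intros]:
  "continuous_on s f \<Longrightarrow> continuous_on s g \<Longrightarrow> continuous_on s (\<lambda>x. cinner (f x) (g x :: 'a::complex_inner))"
  by (rule bounded_bilinear.continuous_on[OF bounded_bilinear_cinner])

lemmas cinner_distribs = cinner_add_left cinner_add_right cinner_scaleC_left cinner_scaleC_right
  cinner_diff_left cinner_diff_right cinner_sum_left cinner_sum_right

lemma cinner_eq_zero_commute: "cinner x y = 0 \<longleftrightarrow> cinner y (x::'a::complex_inner) = 0"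
  by (metis cinner_commute complex_cnj_zero)

lemma cinner_self_eq_one: "cinner x x = 1 \<longleftrightarrow> norm (x::'a::complex_inner) = 1"
proof -
  have "(norm x)\<^sup>2 = 1 \<longleftrightarrow> norm x = 1"
    by (metis norm_ge_zero one_power2 power2_eq_1_iff order.trans zero_le_one neg_0_le_iff_le not_one_le_zero)
  then show ?thesis
    unfolding cinner_self by (metis of_real_1 of_real_eq_iff)
qed

text \<open>Real statements tested on both \<open>y\<close> and \<open>\<i> *\<^sub>C y\<close>
  become complex ones; orthogonality and weak convergence are transferred in this way from the real
  theory.\<close>

lemma Im_cinner: "Im (cinner x y) = inner x (\<i> *\<^sub>C (y::'a::complex_inner))"
  by (simp add: cinner_scaleC_right flip: Re_cinner)

lemma cinner_eq_zero_of_span: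
  assumes "\<And>f. f \<in> F \<Longrightarrow> cinner y f = 0" "x \<in> cspan F"
  shows "cinner y (x::'a::complex_inner) = 0"
  using assms(2) by (induction rule: complex_vector.span_induct_alt) 
    (simp_all add: assms(1) cinner_distribs)

lemma subspace_cspan: "subspace (cspan (F::'a::complex_inner set))"
  by (auto simp: subspace_def complex_vector.span_zero complex_vector.span_add
      complex_vector.span_scale simp flip: scaleC_of_real)

lemma bounded_clinearD:
  assumes "bounded_clinear T"
  shows "bounded_linear T" "T (c *\<^sub>C x) = c *\<^sub>C T x"
  using assms by (auto simp: bounded_clinear_def)

lemma bounded_clinear_simps:
  assumes "bounded_clinear T"
  shows "T 0 = 0" "T (x + y) = T x + T y" "T (x - y) = T x - T y" "T (sum f I) = (\<Sum>i\<in>I. T (f i))"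
  using bounded_clinearD(1)[OF assms]
  by (simp_all add: linear_simps linear_0 linear_sum bounded_linear.linear)

section \<open>Orthonormal families and Gram-Schmidt\<close>

lemma norm_sum_orthonormal:
  assumes "orthonormal_on I x" "finite I"
  shows "(norm (\<Sum>i\<in>I. c i *\<^sub>C x i))\<^sup>2 = (\<Sum>i\<in>I. (cmod (c i))\<^sup>2)"
proof -
  have "complex_of_real ((norm (\<Sum>i\<in>I. c i *\<^sub>C x i))\<^sup>2) = (\<Sum>i\<in>I. \<Sum>j\<in>I. c j * (cnj (c i) * (if j = i then 1 else 0)))"
    unfolding cinner_self[symmetric] cinner_distribs sum_distrib_left
    using assms(1) by (intro sum.cong) (auto simp: orthonormal_on_def)
  also have "\<dots> = (\<Sum>i\<in>I. c i * cnj (c i))"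
    using assms(2) by (intro sum.cong) (auto simp: if_distrib if_distribR cong: if_cong)
  also have "\<dots> = of_real (\<Sum>i\<in>I. (cmod (c i))\<^sup>2)"
    by (simp add: mult_cnj_self)
  finally show ?thesis by (metis of_real_eq_iff)
qed

lemma bessel_orthogonal:
  assumes "orthonormal_on I x" "finite I" "i \<in> I"
  shows "cinner (y - (\<Sum>i\<in>I. cinner y (x i) *\<^sub>C x i)) (x i) = 0"
proof -
  have "cinner (\<Sum>i\<in>I. cinner y (x i) *\<^sub>C x i) (x i) = (\<Sum>j\<in>I. if j = i then cinner y (x i) else 0)"
    unfolding cinner_distribs using assms by (intro sum.cong) (auto simp: orthonormal_on_def)
  then show ?thesis using assms by (simp add: cinner_distribs)
qed

lemma pythagoras:
  assumes "cinner x y = (0::complex)"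
  shows "(norm (x + y))\<^sup>2 = (norm x)\<^sup>2 + (norm (y::'a::complex_inner))\<^sup>2"
proof -
  have "inner x y = 0" using assms by (simp flip: Re_cinner)
  then show ?thesis by (simp add: power2_norm_eq_inner algebra_simps inner_commute)
qed

lemma norm_add_square:
  "(norm (x + y))\<^sup>2 = (norm x)\<^sup>2 + (norm y)\<^sup>2 + 2 * Re (cinner x (y::'a::complex_inner))"
  by (simp add: power2_norm_eq_inner Re_cinner algebra_simps inner_commute)

text \<open>Gram-Schmidt, with the set serving as its own index: a vector whose residual
  \<open>r\<close> vanishes adds nothing, any other adds its normalised residual. Finite-rank
  projections are later written down explicitly through such a \<open>G\<close>.\<close>

lemma orthonormal_set_extend:
  fixes F :: "'a::complex_inner set"
  assumes "finite F"
  obtains G where "finite G" "orthonormal_on G (\<lambda>x. x)" "F \<subseteq> cspan G"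
  using assms
proof (induction F arbitrary: thesis rule: finite_induct)
  case empty
  show ?case by (rule empty[of "{}"]) (auto simp: orthonormal_on_def)
next
  case (insert f F)
  obtain G where G: "finite G" "orthonormal_on G (\<lambda>x. x)" "F \<subseteq> cspan G"
    using insert.IH by blast
  define r where "r = f - (\<Sum>g\<in>G. cinner f g *\<^sub>C g)"
  define s where "s = (\<Sum>g\<in>G. cinner f g *\<^sub>C g)"
  have fr: "f = r + s" by (simp add: r_def s_def)
  have rG: "cinner r g = 0" if "g \<in> G" for g
    unfolding r_def using bessel_orthogonal[OF G(2,1) that] by simp
  have s: "s \<in> cspan G"
    unfolding s_def by (intro complex_vector.span_sum complex_vector.span_scale complex_vector.span_base)
  show ?case
  proof (cases "r = 0")
    case True
    then show ?thesis using G s fr by (intro insert.prems[of G]) auto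
  next
    case False
    define h where "h = complex_of_real (1 / norm r) *\<^sub>C r"
    have r: "r = complex_of_real (norm r) *\<^sub>C h"
      using False by (simp add: h_def scaleC_of_real)
    have "norm h = 1" using False by (simp add: h_def norm_divide)
    moreover have "cinner h g = 0" "cinner g h = 0" if "g \<in> G" for g
      using rG[OF that] cinner_eq_zero_commute[of g r]
      by (simp_all add: h_def cinner_scaleC_left cinner_scaleC_right)
    moreover have "h \<notin> G"
      using calculation by (metis cinner_self_eq_one zero_neq_one)
    ultimately have "orthonormal_on (insert h G) (\<lambda>x. x)"
      using G(2) by (auto simp: orthonormal_on_def cinner_self_eq_one)
    moreover have mono: "cspan G \<subseteq> cspan (insert h G)"
      by (intro complex_vector.span_mono) auto
    moreover have "f \<in> cspan (insert h G)"
    proof -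
      have "complex_of_real (norm r) *\<^sub>C h \<in> cspan (insert h G)"
        by (intro complex_vector.span_scale complex_vector.span_base) simp
      then show ?thesis
        unfolding fr using s mono r by (auto intro: complex_vector.span_add)
    qed
    ultimately show ?thesis using G by (intro insert.prems[of "insert h G"]) auto
  qed
qed

lemma unit_vector_orthogonal:
  fixes F :: "'a::complex_inner set"
  assumes "infinite_dimensional TYPE('a)" "finite F"
  obtains y where "norm y = 1" "\<And>f. f \<in> F \<Longrightarrow> cinner y f = 0"
proof -
  obtain G where G: "finite G" "orthonormal_on G (\<lambda>x. x)" "F \<subseteq> cspan G"
    using orthonormal_set_extend[OF assms(2)] .
  then obtain z where z: "z \<notin> cspan G"
    using assms(1) by (auto simp: infinite_dimensional_def)
  define r where "r = z - (\<Sum>g\<in>G. cinner z g *\<^sub>C g)"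
  have "(\<Sum>g\<in>G. cinner z g *\<^sub>C g) \<in> cspan G"
    by (intro complex_vector.span_sum complex_vector.span_scale complex_vector.span_base)
  then have "r \<noteq> 0" using z by (auto simp: r_def)
  moreover have "cinner r f = 0" if "f \<in> F" for f
    unfolding r_def by (rule cinner_eq_zero_of_span[OF bessel_orthogonal[OF G(2,1)]]) (use that G in auto)
  ultimately show ?thesis
    by (intro that[of "complex_of_real (1 / norm r) *\<^sub>C r"]) (auto simp: cinner_scaleC_left norm_divide)
qed

section \<open>Weak sequential compactness\<close>

text \<open>Near-minimisers of the norm form a Cauchy sequence by the parallelogram law, even when
  the sets shrink, because the minimal norms \<open>d n\<close> increase to a finite limit. Constant
  sequences give orthogonal projections; convex hulls of tails give weak limits.\<close>

lemma decseq_convex_min_norm: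
  fixes C :: "nat \<Rightarrow> 'a::{real_inner,complete_space} set"
  assumes conv: "\<And>n. convex (C n)" and bdd: "\<And>n. \<exists>x\<in>C n. norm x \<le> B" and dec: "decseq C"
  obtains x c where "\<And>n. x n \<in> C n" "x \<longlonglongrightarrow> c" "\<And>z. (\<And>n. z \<in> C n) \<Longrightarrow> norm c \<le> norm z"
proof -
  define d where "d n = Inf (norm ` C n)" for n
  have below: "bdd_below (norm ` C n)" for n
    by (rule bdd_belowI[of _ 0]) auto
  have d_le: "d n \<le> norm z" if "z \<in> C n" for n z
    unfolding d_def using that by (intro cInf_lower below) auto
  have d_nonneg: "0 \<le> d n" for n
    unfolding d_def using bdd[of n] by (intro cInf_greatest) auto
  have "incseq d"
  proof (rule incseq_SucI)
    fix n
    show "d n \<le> d (Suc n)"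
      unfolding d_def using bdd[of "Suc n"] dec
      by (intro cInf_superset_mono below image_mono) (auto simp: decseq_Suc_iff)
  qed
  moreover have "d n \<le> B" for n
    using bdd[of n] d_le by force
  ultimately obtain D where D: "d \<longlonglongrightarrow> D" "\<And>n. d n \<le> D"
    using incseq_convergent by metis
  have "\<exists>z\<in>C n. norm z < d n + 1 / Suc n" for n
    using cInf_lessD[of "norm ` C n" "d n + 1 / Suc n"] bdd[of n] by (auto simp: d_def)
  then obtain x where x: "\<And>n. x n \<in> C n" "\<And>n. norm (x n) < d n + 1 / Suc n"
    by metis
  have lim_norm: "(\<lambda>n. norm (x n)) \<longlonglongrightarrow> D"
  proof (rule tendsto_sandwich[of d _ _ "\<lambda>n. d n + 1 / Suc n"])
    show "(\<lambda>n. d n + 1 / Suc n) \<longlonglongrightarrow> D"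
      using tendsto_add[OF D(1) lim_1_over_n[THEN LIMSEQ_Suc]] by simp
    show "\<forall>\<^sub>F n in sequentially. norm (x n) \<le> d n + 1 / Suc n"
      using x(2) by (intro always_eventually allI less_imp_le)
  qed (use D x d_le in auto)
  \<comment> \<open>For \<open>n \<le> m\<close> both vectors lie in the larger set
    \<open>C n\<close>, hence so does their midpoint, whose norm is at least \<open>d n\<close>. All
    three norms tend to \<open>D\<close>, so the right-hand side tends to 0.\<close>
  have parallelogram: "(norm (x n - x m))\<^sup>2 \<le> 2 * (norm (x n))\<^sup>2 + 2 * (norm (x m))\<^sup>2 - 4 * (d n)\<^sup>2"
    if "n \<le> m" for n m
  proof -
    have "x m \<in> C n" using x(1)[of m] dec that by (auto simp: decseq_def)
    then have "(1/2) *\<^sub>R x n + (1/2) *\<^sub>R x m \<in> C n"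
      using x(1)[of n] conv[of n] by (intro convexD) auto
    then have "d n \<le> norm ((1/2) *\<^sub>R (x n + x m))"
      using d_le by (simp add: scaleR_add_right)
    then have "2 * d n \<le> norm (x n + x m)" by simp
    then have "(2 * d n)\<^sup>2 \<le> (norm (x n + x m))\<^sup>2"
      using d_nonneg by (intro power_mono) auto
    then show ?thesis
      by (simp add: power2_norm_eq_inner power_mult_distrib algebra_simps inner_commute)
  qed
  have "Cauchy x"
  proof (rule metric_CauchyI)
    fix e :: real assume e: "e > 0"
    \<comment> \<open>The three deviations enter the parallelogram bound with weights 2, 2 and
      4.\<close>
    define \<delta> where "\<delta> = e\<^sup>2 / 8"
    have "\<delta> > 0" using e by (simp add: \<delta>_def)
    have "\<forall>\<^sub>F n in sequentially. dist ((norm (x n))\<^sup>2) (D\<^sup>2) < \<delta> \<and> dist ((d n)\<^sup>2) (D\<^sup>2) < \<delta>"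
      using \<open>\<delta> > 0\<close> lim_norm D(1)
      by (intro eventually_conj tendstoD tendsto_power) auto
    then obtain N where N: "\<And>n. n \<ge> N \<Longrightarrow> \<bar>(norm (x n))\<^sup>2 - D\<^sup>2\<bar> < \<delta>" "\<And>n. n \<ge> N \<Longrightarrow> \<bar>(d n)\<^sup>2 - D\<^sup>2\<bar> < \<delta>"
      by (auto simp: eventually_sequentially dist_real_def)
    have close: "dist (x n) (x m) < e" if "N \<le> n" "n \<le> m" for n m
    proof -
      have "(norm (x n - x m))\<^sup>2 < 8 * \<delta>"
        using parallelogram[OF that(2)] N[of n] N(1)[of m] that by linarith
      then have "(norm (x n - x m))\<^sup>2 < e\<^sup>2" by (simp add: \<delta>_def)
      then show ?thesis using e by (simp add: dist_norm power_less_imp_less_base)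
    qed
    show "\<exists>M. \<forall>m\<ge>M. \<forall>n\<ge>M. dist (x m) (x n) < e"
      using close by (metis dist_commute linorder_le_cases)
  qed
  then obtain c where c: "x \<longlonglongrightarrow> c"
    using Cauchy_convergent_iff convergent_def by blast
  have "norm c = D"
    using LIMSEQ_unique[OF tendsto_norm[OF c] lim_norm] .
  moreover have "D \<le> norm z" if "\<And>n. z \<in> C n" for z
    using D(1) d_le[OF that] by (intro LIMSEQ_le_const2) auto
  ultimately show ?thesis using that x(1) c by metis
qed

text \<open>The limit \<open>c\<close> of near-minimisers in the translate \<open>y - S\<close> is
  the residual. Subtracting the best multiple \<open>t\<close> of \<open>s\<close> would shorten it
  unless \<open>c\<close> is orthogonal to \<open>s\<close>.\<close>

lemma orthogonal_projection_exists:
  fixes S :: "'a::{real_inner,complete_space} set"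
  assumes "subspace S" "closed S"
  obtains p where "p \<in> S" "\<And>s. s \<in> S \<Longrightarrow> inner (y - p) s = 0"
proof -
  have "convex ((\<lambda>s. y - s) ` S)"
    using convex_translation[OF convex_negations[OF subspace_imp_convex[OF assms(1)]], of y]
    by (simp add: image_image)
  moreover have "\<exists>z\<in>(\<lambda>s. y - s) ` S. norm z \<le> norm y"
    using subspace_0[OF assms(1)] by force
  ultimately obtain x c where x: "\<And>n::nat. x n \<in> (\<lambda>s. y - s) ` S" "x \<longlonglongrightarrow> c"
      "\<And>z. z \<in> (\<lambda>s. y - s) ` S \<Longrightarrow> norm c \<le> norm z"
    using decseq_convex_min_norm[of "\<lambda>_. (\<lambda>s. y - s) ` S"] by (metis decseq_const)
  have "y - c \<in> S"
  proof (rule closed_sequentially[OF assms(2) _ tendsto_diff[OF tendsto_const x(2)]])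
    show "y - x n \<in> S" for n using x(1)[of n] by force
  qed
  moreover have "inner c s = 0" if "s \<in> S" for s
  proof (cases "s = 0")
    case False
    define t where "t = inner c s / (inner s s)"
    have "c - t *\<^sub>R s = y - ((y - c) + t *\<^sub>R s)" by simp
    then have "c - t *\<^sub>R s \<in> (\<lambda>s. y - s) ` S"
      using \<open>y - c \<in> S\<close> that assms(1) by (metis image_eqI subspace_add subspace_scale)
    then have "(norm c)\<^sup>2 \<le> (norm (c - t *\<^sub>R s))\<^sup>2"
      using x(3) by (intro power_mono) auto
    also have "\<dots> = (norm c)\<^sup>2 - 2 * t * inner c s + t * (t * inner s s)"
      by (simp add: power2_norm_eq_inner algebra_simps inner_commute)
    also have "t * inner s s = inner c s" using False by (simp add: t_def)
    finally have "t * inner c s \<le> 0" by simp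
    then have "(inner c s)\<^sup>2 / inner s s \<le> 0" by (simp add: t_def power2_eq_square)
    moreover have "inner s s > 0" using False by simp
    ultimately show ?thesis
      by (metis divide_pos_pos not_le power2_eq_iff zero_less_power2)
  qed simp
  ultimately show ?thesis
    using that[of "y - c"] by simp
qed

text \<open>The uniform bound makes convergence of the inner products stable under norm limits of
  the test vector, by a three-epsilon argument. This reduces weak convergence to convergence on a
  generating set.\<close>

lemma convergent_inner_closed_subspace:
  fixes x :: "nat \<Rightarrow> 'a::real_inner"
  assumes B: "\<And>n. norm (x n) \<le> B"
  shows "subspace {y. convergent (\<lambda>n. inner (x n) y)}" "closed {y. convergent (\<lambda>n. inner (x n) y)}"
proof -
  show "subspace {y. convergent (\<lambda>n. inner (x n) y)}"
    by (auto simp: subspace_def inner_add_right convergent_const intro!: convergent_add convergent_mult)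
  have "convergent (\<lambda>n. inner (x n) y)" if s: "\<And>i. convergent (\<lambda>n. inner (x n) (s i))" "s \<longlonglongrightarrow> y" for s :: "nat \<Rightarrow> 'a" and y
  proof -
    have "Cauchy (\<lambda>n. inner (x n) y)"
    proof (rule metric_CauchyI)
      fix e :: real assume e: "e > 0"
      have B0: "B \<ge> 0" using B[of 0] norm_ge_zero order_trans by blast
      \<comment> \<open>The \<open>+ 1\<close> covers \<open>B = 0\<close> and makes
        \<open>B * \<delta>\<close> strictly smaller than \<open>e / 3\<close>.\<close>
      define \<delta> where "\<delta> = e / (3 * (B + 1))"
      have \<delta>: "\<delta> > 0" "B * \<delta> < e / 3" using B0 e by (auto simp: \<delta>_def field_simps)
      obtain i where i: "norm (s i - y) < \<delta>"
        using s(2) \<delta>(1) by (metis LIMSEQ_iff order_refl)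
      have near: "\<bar>inner (x n) (s i) - inner (x n) y\<bar> < e / 3" for n
      proof -
        have "\<bar>inner (x n) (s i - y)\<bar> \<le> norm (x n) * norm (s i - y)" by (rule Cauchy_Schwarz_ineq2)
        also have "\<dots> \<le> B * \<delta>" using B[of n] B0 i by (intro mult_mono) auto
        finally show ?thesis using \<delta>(2) by (simp add: inner_diff_right)
      qed
      have "Cauchy (\<lambda>n. inner (x n) (s i))" using s(1) by (simp add: Cauchy_convergent_iff)
      then obtain N where N: "\<And>m n. m \<ge> N \<Longrightarrow> n \<ge> N \<Longrightarrow> \<bar>inner (x m) (s i) - inner (x n) (s i)\<bar> < e / 3"
        using e by (metis metric_CauchyD dist_real_def divide_pos_pos zero_less_numeral)
      have "dist (inner (x m) y) (inner (x n) y) < e" if "m \<ge> N" "n \<ge> N" for m n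
        using N[OF that] near[of m] near[of n] unfolding dist_real_def by linarith
      then show "\<exists>M. \<forall>m\<ge>M. \<forall>n\<ge>M. dist (inner (x m) y) (inner (x n) y) < e" by blast
    qed
    then show ?thesis by (simp add: Cauchy_convergent_iff)
  qed
  then show "closed {y. convergent (\<lambda>n. inner (x n) y)}"
    unfolding closed_sequential_limits by blast
qed

text \<open>The space may be non-separable, so the diagonal argument tests only against the
  countably many terms \<open>x m\<close>. An arbitrary \<open>y\<close> is split into its
  projection \<open>p\<close> onto the closed subspace of good test vectors and a rest orthogonal to
  all \<open>x m\<close>, on which the inner products are 0.\<close>

lemma bounded_imp_weakly_convergent_subseq:
  fixes x :: "nat \<Rightarrow> 'a::{real_inner,complete_space}"
  assumes B: "\<And>n. norm (x n) \<le> B"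
  obtains r u where "strict_mono r" "\<And>y. (\<lambda>n. inner (x (r n)) y) \<longlonglongrightarrow> inner u y"
proof -
  interpret subseqs "\<lambda>m s. convergent (\<lambda>n. inner (x (s n)) (x m))"
  proof
    fix m :: nat and s :: "nat \<Rightarrow> nat"
    have "bounded (range (\<lambda>n. inner (x (s n)) (x m)))"
    proof (rule boundedI)
      fix z assume "z \<in> range (\<lambda>n. inner (x (s n)) (x m))"
      then obtain n where "z = inner (x (s n)) (x m)" by blast
      then have "norm z \<le> norm (x (s n)) * norm (x m)" by (simp add: Cauchy_Schwarz_ineq2)
      also have "\<dots> \<le> B * norm (x m)" using B by (intro mult_right_mono) auto
      finally show "norm z \<le> B * norm (x m)" .
    qed
    then obtain l r where "strict_mono r" "((\<lambda>n. inner (x (s n)) (x m)) \<circ> r) \<longlonglongrightarrow> l"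
      using bounded_imp_convergent_subsequence by blast
    then show "\<exists>r. strict_mono r \<and> convergent (\<lambda>n. inner (x ((s \<circ> r) n)) (x m))"
      by (auto simp: o_def convergent_def)
  qed
  define z where "z n = x (diagseq n)" for n
  let ?N = "{y. convergent (\<lambda>n. inner (z n) y)}"
  have "convergent (\<lambda>n. inner (z n) (x m))" for m
  proof -
    \<comment> \<open>Only from index \<open>Suc m\<close> on is the diagonal a subsequence of the
      one chosen for \<open>x m\<close>; hence the shift, which is then undone.\<close>
    have "convergent (\<lambda>n. inner (x ((diagseq \<circ> ((+) (Suc m))) n)) (x m))"
    proof (rule diagseq_holds)
      fix r s :: "nat \<Rightarrow> nat" and n
      assume "strict_mono r" "convergent (\<lambda>i. inner (x (s i)) (x n))"
      then show "convergent (\<lambda>i. inner (x ((s \<circ> r) i)) (x n))"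
        using convergent_subseq_convergent[of "\<lambda>i. inner (x (s i)) (x n)" r] by (simp add: o_def)
    qed
    then have "convergent (\<lambda>n. inner (z (n + Suc m)) (x m))"
      by (simp add: z_def add.commute)
    then show ?thesis
      using convergent_ignore_initial_segment[of "\<lambda>n. inner (z n) (x m)" "Suc m"] by simp
  qed
  then have range: "x m \<in> ?N" for m by simp
  have Bz: "norm (z n) \<le> B" for n using B by (simp add: z_def)
  have conv: "convergent (\<lambda>n. inner (z n) y)" for y
  proof -
    obtain p where p: "p \<in> ?N" "\<And>s. s \<in> ?N \<Longrightarrow> inner (y - p) s = 0"
      using orthogonal_projection_exists[OF convergent_inner_closed_subspace[of z B, OF Bz]] by metis
    have "inner (z n) (y - p) = 0" for n
      using p(2)[OF range] unfolding z_def by (metis inner_commute)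
    then have "inner (z n) y = inner (z n) p" for n
      by (simp add: inner_diff_right)
    then show ?thesis using p(1) by simp
  qed
  \<comment> \<open>The weak limit is the norm limit of convex combinations of tails of the sequence, so that no
    Riesz representation is needed.\<close>
  define C where "C n = convex hull (z ` {n..})" for n
  have "\<exists>c\<in>C n. norm c \<le> B" for n
    using Bz[of n] by (intro bexI[of _ "z n"]) (auto simp: C_def intro: hull_inc)
  moreover have "decseq C"
    unfolding C_def decseq_def by (intro allI impI hull_mono image_mono) auto
  ultimately obtain c u where c: "\<And>n::nat. c n \<in> C n" "c \<longlonglongrightarrow> u"
    using decseq_convex_min_norm[of C B] convex_convex_hull C_def by metis
  have "(\<lambda>n. inner (z n) y) \<longlonglongrightarrow> inner u y" for y
  proof -
    obtain L where L: "(\<lambda>n. inner (z n) y) \<longlonglongrightarrow> L" using conv by (auto simp: convergent_def)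
    have "(\<lambda>n. inner (c n) y) \<longlonglongrightarrow> L"
    proof (rule tendstoI)
      fix e :: real assume "e > 0"
      then obtain N where N: "\<And>n. n \<ge> N \<Longrightarrow> dist (inner (z n) y) L < e"
        using tendstoD[OF L] by (auto simp: eventually_sequentially)
      have "dist (inner (c n) y) L < e" if "n \<ge> N" for n
      proof -
        have lin: "linear (\<lambda>v. inner v y)"
          by (rule bounded_linear.linear[OF bounded_linear_inner_left])
        \<comment> \<open>The vectors whose inner product with \<open>y\<close> is close to
          \<open>L\<close> form a convex set, so with a tail of \<open>z\<close> it contains the
          hull of that tail.\<close>
        have "convex ((\<lambda>v. inner v y) -` ball L e)"
          by (rule convex_linear_vimage[OF lin convex_ball])
        then have "C n \<subseteq> (\<lambda>v. inner v y) -` ball L e"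
          unfolding C_def using N that by (intro hull_minimal) (auto simp: dist_commute)
        then show ?thesis using c(1)[of n] by (auto simp: dist_commute)
      qed
      then show "\<forall>\<^sub>F n in sequentially. dist (inner (c n) y) L < e"
        by (auto simp: eventually_sequentially)
    qed
    moreover have "(\<lambda>n. inner (c n) y) \<longlonglongrightarrow> inner u y"
      by (intro tendsto_inner c tendsto_const)
    ultimately show ?thesis using L LIMSEQ_unique by blast
  qed
  then show ?thesis using that[OF subseq_diagseq, of u] unfolding z_def by blast
qed

lemma bounded_imp_weakly_convergent_subseq_family:
  fixes x :: "nat \<Rightarrow> nat \<Rightarrow> 'a::{real_inner,complete_space}"
  assumes B: "\<And>l n. l < k \<Longrightarrow> norm (x l n) \<le> B"
  obtains r u where "strict_mono r" "\<And>l y. l < k \<Longrightarrow> (\<lambda>n. inner (x l (r n)) y) \<longlonglongrightarrow> inner (u l) y"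
proof -
  have "\<exists>r u. strict_mono r \<and> (\<forall>l<k. \<forall>y. (\<lambda>n. inner (x l (r n)) y) \<longlonglongrightarrow> inner (u l) y)"
    using B
  proof (induction k)
    case 0
    show ?case using strict_mono_id by blast
  next
    case (Suc k)
    then obtain r u where r: "strict_mono r" "\<And>l y. l < k \<Longrightarrow> (\<lambda>n. inner (x l (r n)) y) \<longlonglongrightarrow> inner (u l) y"
      by (metis less_Suc_eq)
    obtain s v where s: "strict_mono s" "\<And>y. (\<lambda>n. inner (x k (r (s n))) y) \<longlonglongrightarrow> inner v y"
      using bounded_imp_weakly_convergent_subseq[of "\<lambda>n. x k (r n)" B] Suc.prems by auto
    have "(\<lambda>n. inner (x l (r (s n))) y) \<longlonglongrightarrow> inner (u l) y" if "l < k" for l y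
      using LIMSEQ_subseq_LIMSEQ[OF r(2)[OF that] s(1)] by (simp add: o_def)
    then show ?case
      using strict_mono_o[OF r(1) s(1)] s(2)
      by (intro exI[of _ "r \<circ> s"] exI[of _ "u(k := v)"]) (auto simp: less_Suc_eq o_def)
  qed
  then show ?thesis using that by blast
qed

section \<open>Orthonormal bases, finite-rank and positive operators\<close>

lemma subspace_closure_of_subspace:
  fixes S :: "'a::real_normed_vector set"
  assumes "subspace S"
  shows "subspace (closure S)"
  unfolding subspace_def
proof (intro conjI ballI allI)
  show "0 \<in> closure S" using subspace_0[OF assms] closure_subset by blast
next
  fix x y assume "x \<in> closure S" "y \<in> closure S"
  then obtain f g where "\<And>n. f n \<in> S" "f \<longlonglongrightarrow> x" "\<And>n. g n \<in> S" "g \<longlonglongrightarrow> y"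
    unfolding closure_sequential by blast
  then have "\<And>n. f n + g n \<in> S" "(\<lambda>n. f n + g n) \<longlonglongrightarrow> x + y"
    using subspace_add[OF assms] tendsto_add by blast+
  then show "x + y \<in> closure S"
    unfolding closure_sequential by (intro exI[of _ "\<lambda>n. f n + g n"]) auto
next
  fix c x assume "x \<in> closure S"
  then obtain f where "\<And>n. f n \<in> S" "f \<longlonglongrightarrow> x"
    unfolding closure_sequential by blast
  then have "\<And>n. c *\<^sub>R f n \<in> S" "(\<lambda>n. c *\<^sub>R f n) \<longlonglongrightarrow> c *\<^sub>R x"
    using subspace_scale[OF assms] by (auto intro: tendsto_scaleR)
  then show "c *\<^sub>R x \<in> closure S"
    unfolding closure_sequential by (intro exI[of _ "\<lambda>n. c *\<^sub>R f n"]) auto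
qed

lemma unit_vector_orthogonal_non_total:
  fixes F :: "'a::complex_hilbert set"
  assumes "closure (cspan F) \<noteq> UNIV"
  obtains r where "norm r = 1" "\<And>f. f \<in> F \<Longrightarrow> cinner r f = 0"
proof -
  obtain y where y: "y \<notin> closure (cspan F)" using assms by blast
  obtain p where p: "p \<in> closure (cspan F)" "\<And>s. s \<in> closure (cspan F) \<Longrightarrow> inner (y - p) s = 0"
    using orthogonal_projection_exists[OF subspace_closure_of_subspace[OF subspace_cspan] closed_closure] by metis
  have "cinner (y - p) f = 0" if "f \<in> F" for f
  proof -
    have "f \<in> closure (cspan F)" "\<i> *\<^sub>C f \<in> closure (cspan F)"
      using closure_subset[of "cspan F"] complex_vector.span_base[OF that] complex_vector.span_scale by auto
    then show ?thesis
      using p(2) by (simp add: complex_eq_iff Im_cinner) (simp add: Re_cinner)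
  qed
  moreover have "y - p \<noteq> 0" using y p by auto
  ultimately show ?thesis
    by (intro that[of "complex_of_real (1 / norm (y - p)) *\<^sub>C (y - p)"])
      (simp_all add: cinner_scaleC_left norm_divide)
qed

text \<open>\<open>op_trace\<close> selects a basis by \<open>SOME\<close>, so existence must be
  known before any trace can be evaluated. By Zorn's lemma there is a maximal orthonormal set; were
  it not total, a unit vector orthogonal to it would enlarge it.\<close>

lemma orthonormal_basis_exists:
  obtains B :: "'a::complex_hilbert set" where "orthonormal_basis_on B (\<lambda>b. b)"
proof -
  let ?A = "{B :: 'a set. orthonormal_on B (\<lambda>b. b)}"
  have "\<exists>M\<in>?A. \<forall>X\<in>?A. M \<subseteq> X \<longrightarrow> X = M"
  proof (rule subset_Zorn')
    fix C assume C: "subset.chain ?A C"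
    have "cinner x y = (if x = y then 1 else 0)" if xy: "x \<in> \<Union>C" "y \<in> \<Union>C" for x y
    proof -
      obtain B B' where B: "B \<in> C" "x \<in> B" "B' \<in> C" "y \<in> B'"
        using xy by blast
      then have "B \<subseteq> B' \<or> B' \<subseteq> B"
        using C unfolding subset_chain_def by blast
      then obtain E where "E \<in> C" "x \<in> E" "y \<in> E" using B by blast
      moreover from this have "orthonormal_on E (\<lambda>b. b)"
        using C unfolding subset_chain_def by blast
      ultimately show ?thesis unfolding orthonormal_on_def by blast
    qed
    then show "\<Union>C \<in> ?A" by (simp add: orthonormal_on_def)
  qed
  then obtain B :: "'a set" where B: "orthonormal_on B (\<lambda>b. b)"
    and max: "\<And>X. orthonormal_on X (\<lambda>b. b) \<Longrightarrow> B \<subseteq> X \<Longrightarrow> X = B"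
    by auto
  have "closure (cspan B) = UNIV"
  proof (rule ccontr)
    assume "closure (cspan B) \<noteq> UNIV"
    then obtain r where r: "norm r = 1" "\<And>f. f \<in> B \<Longrightarrow> cinner r f = 0"
      using unit_vector_orthogonal_non_total by blast
    then have "r \<notin> B" by (metis cinner_self_eq_one zero_neq_one)
    moreover have "cinner f r = 0" if "f \<in> B" for f
      using r(2)[OF that] cinner_eq_zero_commute by blast
    ultimately have "orthonormal_on (insert r B) (\<lambda>b. b)"
      using B r by (auto simp: orthonormal_on_def cinner_self_eq_one)
    then show False using max \<open>r \<notin> B\<close> by blast
  qed
  then show ?thesis using that B by (simp add: orthonormal_basis_on_def)
qed

lemma orthonormal_on_subset: "orthonormal_on I e \<Longrightarrow> J \<subseteq> I \<Longrightarrow> orthonormal_on J e"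
  unfolding orthonormal_on_def by blast

lemma cspan_image_finite_subset:
  assumes "z \<in> cspan (e ` I)"
  obtains F where "finite F" "F \<subseteq> I" "z \<in> cspan (e ` F)"
proof -
  obtain t c where t: "finite t" "t \<subseteq> e ` I" "z = (\<Sum>a\<in>t. c a *\<^sub>C a)"
    using assms unfolding complex_vector.span_explicit by blast
  obtain F where F: "F \<subseteq> I" "finite F" "t = e ` F" using finite_subset_image[OF t(1,2)] by auto
  have "z \<in> cspan t"
    unfolding t(3) by (intro complex_vector.span_sum complex_vector.span_scale complex_vector.span_base)
  then show ?thesis using that F by blast
qed

text \<open>Partial sums are best approximations. Fix \<open>z\<close> in the dense span within
  \<epsilon> of \<open>x\<close>, using the finitely many indices \<open>F0\<close>; every finite
  \<open>F\<close> containing \<open>F0\<close> then does at least as well as \<open>z\<close>. The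
  index set may be uncountable.\<close>

lemma orthonormal_basis_has_sum:
  assumes "orthonormal_basis_on I e"
  shows "((\<lambda>i. cinner x (e i) *\<^sub>C e i) has_sum x) I"
  unfolding has_sum_def
proof (rule tendstoI)
  fix \<epsilon> :: real assume "\<epsilon> > 0"
  then obtain z where z: "z \<in> cspan (e ` I)" "norm (x - z) < \<epsilon>"
    using assms closure_approachable[of x "cspan (e ` I)"]
    by (auto simp: orthonormal_basis_on_def dist_norm norm_minus_commute)
  obtain F0 where F0: "finite F0" "F0 \<subseteq> I" "z \<in> cspan (e ` F0)"
    using cspan_image_finite_subset[OF z(1)] .
  have "dist (\<Sum>i\<in>F. cinner x (e i) *\<^sub>C e i) x < \<epsilon>" if F: "finite F" "F0 \<subseteq> F" "F \<subseteq> I" for F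
  proof -
    define s where "s = (\<Sum>i\<in>F. cinner x (e i) *\<^sub>C e i)"
    have on: "orthonormal_on F e"
      using assms F(3) orthonormal_on_subset by (auto simp: orthonormal_basis_on_def)
    have "s \<in> cspan (e ` F)"
      unfolding s_def by (intro complex_vector.span_sum complex_vector.span_scale complex_vector.span_base) auto
    moreover have "z \<in> cspan (e ` F)"
      using F0(3) complex_vector.span_mono[OF image_mono[OF F(2)], of e] by blast
    ultimately have "s - z \<in> cspan (e ` F)" by (rule complex_vector.span_diff)
    moreover have "cinner (x - s) (e i) = 0" if "i \<in> F" for i
      unfolding s_def by (rule bessel_orthogonal[OF on F(1) that])
    ultimately have "cinner (x - s) (s - z) = 0"
      by (auto intro: cinner_eq_zero_of_span[of "e ` F", rotated])
    then have "(norm (x - s))\<^sup>2 \<le> (norm (x - z))\<^sup>2"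
      using pythagoras[of "x - s" "s - z"] by simp
    then have "norm (x - s) \<le> norm (x - z)"
      by (rule power2_le_imp_le) simp
    then show ?thesis using z(2) by (simp add: s_def dist_norm norm_minus_commute)
  qed
  then show "\<forall>\<^sub>F F in finite_subsets_at_top I. dist (\<Sum>i\<in>F. cinner x (e i) *\<^sub>C e i) x < \<epsilon>"
    unfolding eventually_finite_subsets_at_top using F0 by blast
qed

text \<open>Expand each \<open>w l\<close> in the chosen basis and pair it with \<open>u l\<close>;
  the result no longer mentions the basis. The cases \<open>w = u\<close> and
  \<open>w l = A j (u l)\<close> give the traces of \<open>P\<close> and of \<open>A j\<close>
  composed with \<open>P\<close>.\<close>

lemma op_trace_finite_rank:
  fixes u w :: "nat \<Rightarrow> 'a::complex_hilbert"
  shows "op_trace (\<lambda>x. \<Sum>l<k. cinner x (u l) *\<^sub>C w l) = (\<Sum>l<k. cinner (w l) (u l))"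
proof -
  define B :: "'a set" where "B = (SOME B. orthonormal_basis_on B (\<lambda>b. b))"
  have B: "orthonormal_basis_on B (\<lambda>b. b)"
    unfolding B_def using someI_ex orthonormal_basis_exists by metis
  have "((\<lambda>b. cinner b (u l) * cinner (w l) b) has_sum cinner (w l) (u l)) B" for l
    using has_sum_bounded_linear[OF bounded_linear_cinner_left orthonormal_basis_has_sum[OF B, of "w l"], of "u l"]
    by (simp add: o_def cinner_scaleC_left mult.commute)
  then have "((\<lambda>b. \<Sum>l<k. cinner b (u l) * cinner (w l) b) has_sum (\<Sum>l<k. cinner (w l) (u l))) B"
    by (induction k) (auto intro: has_sum_add)
  then show ?thesis
    unfolding op_trace_def B_def[symmetric] cinner_distribs by (rule infsumI)
qed

section \<open>Bounded and compact operators of finite rank\<close>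

lemma bounded_clinearI:
  assumes "bounded_linear T" "\<And>c x. T (c *\<^sub>C x) = c *\<^sub>C T x"
  shows "bounded_clinear T"
  using assms by (simp add: bounded_clinear_def)

lemma bounded_linear_scaleC_left: "bounded_linear (\<lambda>c. c *\<^sub>C (x::'a::complex_inner))"
  by (rule bounded_linear_intro[of _ "norm x"])
    (simp_all add: complex_vector.scale_left_distrib scaleR_conv_of_real flip: scaleC_of_real complex_vector.scale_scale)

lemma bounded_clinear_rank_one: "bounded_clinear (\<lambda>x. cinner x w *\<^sub>C v)"
  using bounded_linear_compose[OF bounded_linear_scaleC_left bounded_linear_cinner_left]
  by (intro bounded_clinearI) (simp_all add: cinner_scaleC_left)

lemma bounded_clinear_add:
  "bounded_clinear S \<Longrightarrow> bounded_clinear T \<Longrightarrow> bounded_clinear (\<lambda>x. S x + T x)"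
  by (auto simp: bounded_clinear_def complex_vector.scale_right_distrib intro: bounded_linear_add)

lemma bounded_clinear_sum:
  "(\<And>i. i \<in> I \<Longrightarrow> bounded_clinear (T i)) \<Longrightarrow> bounded_clinear (\<lambda>x. \<Sum>i\<in>I. T i x)"
  by (auto simp: bounded_clinear_def complex_vector.scale_sum_right intro: bounded_linear_sum)

lemma bounded_clinear_diff:
  "bounded_clinear S \<Longrightarrow> bounded_clinear T \<Longrightarrow> bounded_clinear (\<lambda>x. S x - T x)"
  by (auto simp: bounded_clinear_def complex_vector.scale_right_diff_distrib intro: bounded_linear_sub)

lemma compact_closure_subset:
  fixes S :: "'a::t2_space set"
  assumes "S \<subseteq> K" "compact K"
  shows "compact (closure S)"
  using assms by (metis closure_minimal compact_imp_closed compact_Int_closed closed_closure inf.absorb_iff2)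

text \<open>The operator factors through the scalar \<open>cinner x w\<close>, which confines the
  image of the unit ball to the image of a closed disc of the plane.\<close>

lemma compact_operator_rank_one: "compact_operator (\<lambda>x. cinner x w *\<^sub>C v)"
proof -
  have "(\<lambda>x. cinner x w *\<^sub>C v) ` cball 0 1 \<subseteq> (\<lambda>c. c *\<^sub>C v) ` cball 0 (norm w)"
  proof
    fix y assume "y \<in> (\<lambda>x. cinner x w *\<^sub>C v) ` cball 0 1"
    then obtain x where x: "norm x \<le> 1" "y = cinner x w *\<^sub>C v" by auto
    have "cmod (cinner x w) \<le> norm w"
      using norm_cinner_le[of x w] mult_right_mono[OF x(1) norm_ge_zero[of w]] by simp
    then show "y \<in> (\<lambda>c. c *\<^sub>C v) ` cball 0 (norm w)" using x by auto
  qed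
  moreover have "compact ((\<lambda>c. c *\<^sub>C v) ` cball 0 (norm w))"
    by (intro compact_continuous_image linear_continuous_on bounded_linear_scaleC_left compact_cball)
  ultimately show ?thesis
    unfolding compact_operator_def using bounded_clinear_rank_one compact_closure_subset by blast
qed

lemma compact_operator_add:
  assumes "compact_operator S" "compact_operator T"
  shows "compact_operator (\<lambda>x. S x + T x)"
proof -
  let ?K = "{x + y | x y. x \<in> closure (S ` cball 0 1) \<and> y \<in> closure (T ` cball 0 1)}"
  have "compact ?K"
    using assms compact_sums by (auto simp: compact_operator_def)
  moreover have "(\<lambda>x. S x + T x) ` cball 0 1 \<subseteq> ?K"
    using closure_subset[of "S ` cball 0 1"] closure_subset[of "T ` cball 0 1"] by blast
  ultimately show ?thesis
    using assms bounded_clinear_add[of S T] compact_closure_subset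
    by (auto simp: compact_operator_def)
qed

lemma compact_operator_sum:
  assumes "finite I" "\<And>i. i \<in> I \<Longrightarrow> compact_operator (T i)"
  shows "compact_operator (\<lambda>x. \<Sum>i\<in>I. T i x)"
  using assms
proof (induction I rule: finite_induct)
  case empty
  show ?case using compact_operator_rank_one[of 0 0] by simp
next
  case (insert i I)
  then show ?case using compact_operator_add[of "T i" "\<lambda>x. \<Sum>i\<in>I. T i x"] by simp
qed

lemma tendsto_cinner_weak:
  assumes "\<And>y. (\<lambda>n. inner (x n) y) \<longlonglongrightarrow> inner u y"
  shows "(\<lambda>n. cinner (x n) y) \<longlonglongrightarrow> cinner u (y::'a::complex_inner)"
  using assms by (simp add: tendsto_complex_iff Re_cinner Im_cinner)

section \<open>Positive semidefinite operators of finite rank\<close>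

lemma positive_semidefiniteD:
  assumes "positive_semidefinite P"
  shows "bounded_clinear P" "cinner (P x) y = cinner x (P y)" "cinner (P x) x = of_real (Re (cinner (P x) x))"
    "0 \<le> Re (cinner (P x) x)"
proof -
  show adj: "cinner (P x) y = cinner x (P y)" for x y
    using assms by (simp add: positive_semidefinite_def selfadjoint_def)
  have "Im (cinner (P x) x) = 0"
    using arg_cong[OF cinner_commute[of "P x" x], of Im] adj[of x x] by simp
  then show "cinner (P x) x = of_real (Re (cinner (P x) x))" by (simp add: complex_eq_iff)
qed (use assms in \<open>auto simp: positive_semidefinite_def selfadjoint_def\<close>)

text \<open>Moving from \<open>w\<close> in the direction \<open>- P w\<close> changes the form by
  \<open>- 2 * t * a + t * t * b\<close>, which is negative for small \<open>t > 0\<close> unless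
  \<open>a = 0\<close>. It guarantees a nonzero pivot in the Cholesky step.\<close>

lemma positive_semidefinite_eq_zero:
  assumes P: "positive_semidefinite P" and "cinner (P w) w = 0"
  shows "P w = 0"
proof (rule ccontr)
  assume "P w \<noteq> 0"
  note P' = positive_semidefiniteD[OF P]
  define b where "b = Re (cinner (P (P w)) (P w))"
  define a where "a = (norm (P w))\<^sup>2"
  \<comment> \<open>This gives \<open>t * b \<le> a\<close>, so the quadratic term takes back at
    most half of the linear decrease; the 1 covers \<open>b = 0\<close>.\<close>
  define t where "t = a / (1 + b)"
  have a: "a > 0" and b: "b \<ge> 0" using \<open>P w \<noteq> 0\<close> P'(4) by (auto simp: a_def b_def)
  let ?v = "w - complex_of_real t *\<^sub>C P w"
  have "0 \<le> Re (cinner (P ?v) ?v)" by (rule P'(4))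
  also have "cinner (P ?v) ?v = - of_real t * (cinner (P w) (P w) + cinner (P (P w)) w) + of_real (t * t) * cinner (P (P w)) (P w)"
    using assms(2) by (simp add: bounded_clinear_simps(3)[OF P'(1)] bounded_clinearD(2)[OF P'(1)] cinner_distribs algebra_simps)
  also have "cinner (P (P w)) w = cinner (P w) (P w)" by (rule P'(2))
  finally have "0 \<le> - (2 * t * a) + t * t * b"
    by (simp add: cinner_self a_def b_def)
  also have "t * t * b \<le> t * a"
  proof -
    have "t * b \<le> a" using a b by (simp add: t_def field_simps)
    moreover have "t \<ge> 0" using a b by (simp add: t_def)
    ultimately show ?thesis using mult_left_mono[of "t * b" a t] by (simp add: mult.assoc)
  qed
  finally have "t * a \<le> 0" by (simp add: mult.commute)
  moreover have "t * a > 0" using a b by (simp add: t_def)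
  ultimately show False by simp
qed

text \<open>No spectral theorem is needed: subtracting \<open>(P w)(P w)\<^sup>* / \<langle>P w, w\<rangle>\<close> keeps \<open>P\<close> positive and
  lowers its rank.\<close>

lemma positive_semidefinite_cholesky:
  assumes "positive_semidefinite P" "rank_at_most k P"
  shows "\<exists>z. \<forall>x. P x = (\<Sum>c<k. cinner x (z c) *\<^sub>C z c)"
  using assms
proof (induction k arbitrary: P)
  case 0
  then have "range P \<subseteq> {0}" by (auto simp: rank_at_most_def)
  then show ?case by auto
next
  case (Suc k)
  note P = positive_semidefiniteD[OF Suc.prems(1)] and clin = bounded_clinear_simps[OF positive_semidefiniteD(1)[OF Suc.prems(1)]]
    bounded_clinearD(2)[OF positive_semidefiniteD(1)[OF Suc.prems(1)]]
  show ?case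
  proof (cases "\<forall>w. P w = 0")
    case True
    then show ?thesis by (intro exI[of _ "\<lambda>_. 0"]) simp
  next
    case False
    then obtain w where w: "P w \<noteq> 0" by blast
    define a where "a = Re (cinner (P w) w)"
    have aw: "cinner (P w) w = of_real a" unfolding a_def by (rule P(3))
    have "a \<noteq> 0" using positive_semidefinite_eq_zero[OF Suc.prems(1)] w aw by auto
    then have a: "a > 0" using P(4)[of w] by (simp add: a_def)
    define z where "z = complex_of_real (1 / sqrt a) *\<^sub>C P w"
    define P' where "P' x = P x - cinner x z *\<^sub>C z" for x
    have zz: "cinner x z *\<^sub>C z = (cinner x (P w) / of_real a) *\<^sub>C P w" for x
    proof -
      have "complex_of_real a = of_real (sqrt a) * of_real (sqrt a)"
        using a by (simp flip: of_real_mult)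
      then show ?thesis by (simp add: z_def cinner_scaleC_right)
    qed
    have P'_eq: "P' x = P x - (cinner x (P w) / of_real a) *\<^sub>C P w" for x
      by (simp add: P'_def zz)
    have bl: "bounded_clinear P'"
      unfolding P'_def by (intro bounded_clinear_diff P bounded_clinear_rank_one)
    have "cinner (P' x) y = cinner x (P' y)" for x y
    proof -
      have "cinner (P w) y = cnj (cinner y (P w))" by (rule cinner_commute)
      then show ?thesis using P(2)[of x y] by (simp add: P'_eq cinner_distribs)
    qed
    moreover have "0 \<le> Re (cinner (P' x) x)" for x
    proof -
      \<comment> \<open>Completing the square: with this \<open>c\<close> the form of
        \<open>P'\<close> at \<open>x\<close> is the form of \<open>P\<close> at
        \<open>x - c *\<^sub>C w\<close>, which is nonnegative.\<close>
      define c where "c = cinner (P x) w / of_real a"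
      have c: "cinner x (P w) = c * of_real a" using a P(2)[of x w] by (simp add: c_def)
      have c': "cinner (P w) x = cnj c * of_real a" using cinner_commute[of "P w" x] by (simp add: c)
      have "cinner (P (x - c *\<^sub>C w)) (x - c *\<^sub>C w) = cinner (P' x) x"
        using P(2)[of x w] a by (simp add: P'_eq clin cinner_distribs c c' aw algebra_simps)
      then show ?thesis using P(4)[of "x - c *\<^sub>C w"] by simp
    qed
    ultimately have psd: "positive_semidefinite P'"
      using bl by (simp add: positive_semidefinite_def selfadjoint_def)
    \<comment> \<open>The range of \<open>P'\<close> is orthogonal to \<open>w\<close>, whereas
      \<open>P w\<close> is not. So \<open>P w\<close> is independent of a basis of that range, and
      since both lie in the span of \<open>B\<close> the rank has dropped by at least one.\<close>
    have orth: "cinner (P' x) w = 0" for x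
      using a P(2)[of x w] by (simp add: P'_eq cinner_distribs aw)
    obtain B where B: "finite B" "card B \<le> Suc k" "range P \<subseteq> cspan B"
      using Suc.prems(2) by (auto simp: rank_at_most_def)
    obtain B' where B': "B' \<subseteq> range P'" "complex_vector.independent B'" "range P' \<subseteq> cspan B'"
      using complex_vector.maximal_independent_subset[of "range P'"] by metis
    have "P w \<notin> cspan B'"
    proof
      assume "P w \<in> cspan B'"
      moreover have "cinner w f = 0" if "f \<in> B'" for f
        using that B'(1) orth cinner_eq_zero_commute[of w f] by auto
      ultimately have "cinner w (P w) = 0"
        using cinner_eq_zero_of_span by blast
      then show False using aw a cinner_eq_zero_commute[of w "P w"] by simp
    qed
    then have ind: "complex_vector.independent (insert (P w) B')" and "P w \<notin> B'"
      using B'(2) complex_vector.independent_insertI complex_vector.span_base by auto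
    have "insert (P w) B' \<subseteq> cspan B"
      using B(3) B'(1) by (auto simp: P'_eq intro!: complex_vector.span_diff complex_vector.span_scale)
    then have "finite (insert (P w) B') \<and> card (insert (P w) B') \<le> card B"
      by (rule complex_vector.independent_span_bound[OF B(1) ind])
    then have "finite B'" "card (insert (P w) B') \<le> card B" by simp_all
    then have "rank_at_most k P'"
      unfolding rank_at_most_def using B(2) B'(3) \<open>P w \<notin> B'\<close> by (intro exI[of _ B']) auto
    then obtain y where y: "\<And>x. P' x = (\<Sum>c<k. cinner x (y c) *\<^sub>C y c)"
      using Suc.IH[OF psd] by blast
    have "P x = (\<Sum>c<Suc k. cinner x ((y(k := z)) c) *\<^sub>C (y(k := z)) c)" for x
      using y[of x] by (simp add: P'_def algebra_simps)
    then show ?thesis by blast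
  qed
qed

section \<open>The essential numerical range\<close>

definition quad :: "('m::finite \<Rightarrow> 'a::complex_inner \<Rightarrow> 'a) \<Rightarrow> 'a \<Rightarrow> complex ^ 'm" where
  "quad B x = (\<chi> j. cinner (B j x) x)"

lemma quad_nth [simp]: "quad B x $ j = cinner (B j x) x"
  by (simp add: quad_def)

lemma joint_num_range_quad:
  "joint_num_range k B = {\<Sum>l<k. quad B (x l) | x. orthonormal_on {..<k} x}"
proof -
  have "(\<Sum>l<k. quad B (x l)) = (\<chi> j. \<Sum>l<k. cinner (B j (x l)) (x l))" for x
    by (simp add: vec_eq_iff)
  then show ?thesis unfolding joint_num_range_def by simp
qed

lemma joint_num_range_one: "joint_num_range 1 B = {quad B x | x. norm x = 1}"
proof -
  have "orthonormal_on {..<1} x \<longleftrightarrow> norm (x 0) = 1" for x :: "nat \<Rightarrow> 'b"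
    by (auto simp: orthonormal_on_def cinner_self_eq_one)
  then have "joint_num_range 1 B = {quad B (x 0) | x :: nat \<Rightarrow> 'b. norm (x 0) = 1}"
    by (simp add: joint_num_range_quad)
  also have "\<dots> = {quad B x | x. norm x = 1}"
  proof (intro subset_antisym subsetI)
    fix p assume "p \<in> {quad B x | x. norm x = 1}"
    then obtain x where "p = quad B x" "norm x = 1" by blast
    then show "p \<in> {quad B (x 0) | x :: nat \<Rightarrow> 'b. norm (x 0) = 1}"
      by (intro CollectI exI[of _ "\<lambda>_. x"]) simp
  qed auto
  finally show ?thesis .
qed

lemma norm_vec_le_sum: "norm (x :: complex ^ 'm) \<le> (\<Sum>j\<in>UNIV. norm (x $ j))"
  unfolding norm_vec_def by (rule L2_set_le_sum) simp

text \<open>\<open>F\<close> consists of the centres of finitely many small balls covering the image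
  of the unit ball. When \<open>y\<close> is orthogonal to the centre near \<open>K y\<close>, that
  centre may be subtracted from \<open>K y\<close> without changing the inner product.\<close>

lemma compact_operator_small_on_complement:
  assumes "compact_operator K" "\<delta> > 0"
  obtains F where "finite F" "\<And>y. norm y = 1 \<Longrightarrow> (\<And>f. f \<in> F \<Longrightarrow> cinner y f = 0) \<Longrightarrow> cmod (cinner (K y) y) \<le> \<delta>"
proof -
  obtain F where F: "finite F" "closure (K ` cball 0 1) \<subseteq> (\<Union>x\<in>F. ball x \<delta>)"
    using assms unfolding compact_operator_def compact_eq_totally_bounded by metis
  have "cmod (cinner (K y) y) \<le> \<delta>" if y: "norm y = 1" "\<And>f. f \<in> F \<Longrightarrow> cinner y f = 0" for y
  proof -
    have "K y \<in> closure (K ` cball 0 1)" using y(1) closure_subset by fastforce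
    then obtain f where f: "f \<in> F" "norm (K y - f) < \<delta>"
      using F(2) by (auto simp: dist_norm norm_minus_commute)
    have "cinner f y = 0" using y(2)[OF f(1)] cinner_eq_zero_commute by blast
    then have "cinner (K y) y = cinner (K y - f) y" by (simp add: cinner_diff_left)
    then show ?thesis using norm_cinner_le[of "K y - f" y] f(2) y(1) by simp
  qed
  then show ?thesis using that F(1) by blast
qed

text \<open>Quantifying over finite sets, rather than asking for a weakly null sequence, lets each
  new vector avoid everything built so far, including the images under the
  \<open>A j\<close>.\<close>

definition ess_range :: "('m::finite \<Rightarrow> 'a::complex_inner \<Rightarrow> 'a) \<Rightarrow> (complex ^ 'm) set" where
  "ess_range A = {\<xi>. \<forall>F \<epsilon>. finite F \<longrightarrow> \<epsilon> > 0 \<longrightarrow>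
    (\<exists>y. norm y = 1 \<and> (\<forall>f\<in>F. cinner y f = 0) \<and> dist (quad A y) \<xi> < \<epsilon>)}"

lemma ess_rangeE:
  assumes "\<xi> \<in> ess_range A" "finite F" "\<epsilon> > 0"
  obtains y where "norm y = 1" "\<forall>f\<in>F. cinner y f = 0" "dist (quad A y) \<xi> < \<epsilon>"
  using assms unfolding ess_range_def by blast

lemma closed_ess_range: "closed (ess_range A)"
proof -
  have "\<xi> \<in> ess_range A" if \<xi>: "\<xi> \<in> closure (ess_range A)" for \<xi>
    unfolding ess_range_def
  proof (intro CollectI allI impI)
    fix F :: "'b set" and \<epsilon> :: real assume F: "finite F" "\<epsilon> > 0"
    obtain \<zeta> where \<zeta>: "\<zeta> \<in> ess_range A" "dist \<zeta> \<xi> < \<epsilon> / 2"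
      using \<xi> F(2) by (metis closure_approachable half_gt_zero)
    obtain y where "norm y = 1" "\<forall>f\<in>F. cinner y f = 0" "dist (quad A y) \<zeta> < \<epsilon> / 2"
      using ess_rangeE[OF \<zeta>(1) F(1), of "\<epsilon> / 2"] F(2) by auto
    then show "\<exists>y. norm y = 1 \<and> (\<forall>f\<in>F. cinner y f = 0) \<and> dist (quad A y) \<xi> < \<epsilon>"
      using \<zeta>(2) dist_triangle_half_l[of "quad A y" \<zeta> \<epsilon> \<xi>] dist_commute by metis
  qed
  then show ?thesis by (metis closure_subset closure_closed subsetI subset_antisym closed_closure)
qed

locale selfadjoint_tuple =
  fixes A :: "'m::finite \<Rightarrow> 'h::complex_hilbert \<Rightarrow> 'h"
  assumes infinite_dim: "infinite_dimensional TYPE('h)"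
    and selfadj: "\<And>j. selfadjoint (A j)"
begin

lemma clinear: "bounded_clinear (A j)"
  using selfadj by (simp add: selfadjoint_def)

lemma adjoint: "cinner (A j x) y = cinner x (A j y)"
  using selfadj by (simp add: selfadjoint_def)

lemmas A_simps = bounded_clinear_simps[OF clinear] bounded_clinearD(2)[OF clinear]

lemma quad_scaleC: "quad A (c *\<^sub>C x) = (cmod c)\<^sup>2 *\<^sub>R quad A x"
proof -
  have "cinner (A j (c *\<^sub>C x)) (c *\<^sub>C x) = (c * cnj c) * cinner (A j x) x" for j
    by (simp add: A_simps cinner_distribs)
  then show ?thesis by (simp add: vec_eq_iff mult_cnj_self) (simp add: scaleR_conv_of_real)
qed

text \<open>Self-adjointness makes the second cross term vanish along with the first.\<close>

lemma quad_add_orthogonal: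
  assumes "\<And>j. cinner (A j x) y = 0"
  shows "quad A (x + y) = quad A x + quad A y"
proof -
  have "cinner (A j y) x = 0" for j
    using assms[of j] cinner_eq_zero_commute[of y] by (simp add: adjoint)
  then show ?thesis using assms by (simp add: vec_eq_iff A_simps cinner_distribs)
qed

lemma quad_zero [simp]: "quad A 0 = 0"
  by (simp add: vec_eq_iff A_simps)

lemma norm_quad_le: obtains M where "M > 0" "\<And>x. norm (quad A x) \<le> M * (norm x)\<^sup>2"
proof -
  have "\<forall>j. \<exists>K. \<forall>x. norm (A j x) \<le> norm x * K"
    using bounded_linear.bounded[OF bounded_clinearD(1)[OF clinear]] by blast
  then obtain K where K: "\<And>j x. norm (A j x) \<le> norm x * K j" by metis
  define M where "M = (\<Sum>j\<in>UNIV. \<bar>K j\<bar>) + 1"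
  have "norm (quad A x) \<le> M * (norm x)\<^sup>2" for x
  proof -
    have "norm (quad A x) \<le> (\<Sum>j\<in>UNIV. norm (cinner (A j x) x))"
      using norm_vec_le_sum[of "quad A x"] by simp
    also have "\<dots> \<le> (\<Sum>j\<in>UNIV. \<bar>K j\<bar> * (norm x)\<^sup>2)"
    proof (rule sum_mono)
      fix j
      have "norm (cinner (A j x) x) \<le> norm (A j x) * norm x" by (rule norm_cinner_le)
      also have "\<dots> \<le> (norm x * K j) * norm x" using K by (intro mult_right_mono) auto
      also have "\<dots> \<le> \<bar>K j\<bar> * (norm x)\<^sup>2"
        using mult_right_mono[of "K j" "\<bar>K j\<bar>" "(norm x)\<^sup>2"] by (simp add: power2_eq_square ac_simps)
      finally show "norm (cinner (A j x) x) \<le> \<bar>K j\<bar> * (norm x)\<^sup>2" .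
    qed
    also have "\<dots> \<le> M * (norm x)\<^sup>2"
      by (simp add: M_def distrib_right flip: sum_distrib_right)
    finally show ?thesis .
  qed
  moreover have "M > 0" unfolding M_def by (simp add: add_nonneg_pos sum_nonneg)
  ultimately show ?thesis using that by blast
qed

text \<open>After \<open>y\<close> is chosen near \<xi>, the vector \<open>z\<close> for \<zeta> is
  taken orthogonal to \<open>y\<close> and to all \<open>A j y\<close>. Then \<open>sqrt u\<close>
  times \<open>y\<close> plus \<open>sqrt v\<close> times \<open>z\<close> is a unit vector without
  cross terms, and its values are exactly the convex combination.\<close>

lemma convex_ess_range: "convex (ess_range A)"
proof (rule convexI)
  fix \<xi> \<zeta> and u v :: real
  assume \<xi>: "\<xi> \<in> ess_range A" and \<zeta>: "\<zeta> \<in> ess_range A" and uv: "0 \<le> u" "0 \<le> v" "u + v = 1"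
  show "u *\<^sub>R \<xi> + v *\<^sub>R \<zeta> \<in> ess_range A"
    unfolding ess_range_def
  proof (intro CollectI allI impI)
    fix F :: "'h set" and \<epsilon> :: real assume F: "finite F" "\<epsilon> > 0"
    obtain y where y: "norm y = 1" "\<forall>f\<in>F. cinner y f = 0" "dist (quad A y) \<xi> < \<epsilon>"
      using ess_rangeE[OF \<xi> F] .
    have "finite (insert y (F \<union> range (\<lambda>j. A j y)))" using F by simp
    then obtain z where z: "norm z = 1" "\<forall>f\<in>insert y (F \<union> range (\<lambda>j. A j y)). cinner z f = 0"
        "dist (quad A z) \<zeta> < \<epsilon>"
      using ess_rangeE[OF \<zeta> _ F(2)] by metis
    define y' where "y' = complex_of_real (sqrt u) *\<^sub>C y"
    define z' where "z' = complex_of_real (sqrt v) *\<^sub>C z"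
    have yz: "cinner y z = 0" "cinner (A j y) z = 0" for j
      using z(2) cinner_eq_zero_commute[of z] by auto
    have "(norm (y' + z'))\<^sup>2 = 1"
      using pythagoras[of y' z'] yz(1) uv y(1) z(1)
      by (simp add: y'_def z'_def cinner_distribs power_mult_distrib)
    then have "norm (y' + z') = 1"
      by (metis norm_ge_zero power2_eq_1_iff not_one_le_zero neg_0_le_iff_le)
    moreover have "cinner (y' + z') f = 0" if "f \<in> F" for f
      using y(2) z(2) that by (simp add: y'_def z'_def cinner_distribs)
    moreover have "dist (quad A (y' + z')) (u *\<^sub>R \<xi> + v *\<^sub>R \<zeta>) < \<epsilon>"
    proof -
      have "quad A (y' + z') = u *\<^sub>R quad A y + v *\<^sub>R quad A z"
        using yz uv by (subst quad_add_orthogonal) (simp_all add: y'_def z'_def A_simps cinner_distribs quad_scaleC)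
      moreover have "u *\<^sub>R (quad A y - \<xi>) + v *\<^sub>R (quad A z - \<zeta>) \<in> ball 0 \<epsilon>"
        using y(3) z(3) uv by (intro convexD[OF convex_ball]) (auto simp: dist_norm norm_minus_commute)
      ultimately show ?thesis by (simp add: dist_norm algebra_simps norm_minus_commute)
    qed
    ultimately show "\<exists>y. norm y = 1 \<and> (\<forall>f\<in>F. cinner y f = 0) \<and> dist (quad A y) (u *\<^sub>R \<xi> + v *\<^sub>R \<zeta>) < \<epsilon>"
      by blast
  qed
qed

text \<open>If every finite \<open>F\<close> failed, each would leave unit vectors orthogonal to
  \<open>F\<close> with values in the half-space \<open>b \<le> inner a p\<close>. The closures of
  these sets of values have the finite intersection property inside a ball, and a common point would
  be an essential value violating the strict bound.\<close>

lemma ess_range_support: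
  assumes "\<And>\<xi>. \<xi> \<in> ess_range A \<Longrightarrow> inner a \<xi> < b"
  obtains F where "finite F" "\<And>z. (\<And>f. f \<in> F \<Longrightarrow> cinner z f = 0) \<Longrightarrow> inner a (quad A z) \<le> b * (norm z)\<^sup>2"
proof (rule ccontr)
  note support = that
  assume contr: "\<not> thesis"
  define S where "S F = {quad A z | z. norm z = 1 \<and> (\<forall>f\<in>F. cinner z f = 0) \<and> b \<le> inner a (quad A z)}" for F
  have S_ne: "S F \<noteq> {}" if F: "finite F" for F
  proof -
    obtain z where z: "\<forall>f\<in>F. cinner z f = 0" "inner a (quad A z) > b * (norm z)\<^sup>2"
      using contr support F by (meson not_le)
    then have "z \<noteq> 0" by auto
    define w where "w = complex_of_real (1 / norm z) *\<^sub>C z"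
    have "norm w = 1" "\<forall>f\<in>F. cinner w f = 0"
      using \<open>z \<noteq> 0\<close> z(1) by (simp_all add: w_def norm_divide cinner_distribs)
    moreover have "b \<le> inner a (quad A w)"
      using z(2) \<open>z \<noteq> 0\<close> by (simp add: w_def quad_scaleC norm_divide power_divide field_simps)
    ultimately show ?thesis unfolding S_def by blast
  qed
  obtain M where M: "\<And>x. norm (quad A x) \<le> M * (norm x)\<^sup>2" using norm_quad_le by blast
  have "cball 0 M \<inter> (\<Inter>F\<in>{F. finite F}. closure (S F)) \<noteq> {}"
  proof (rule compact_imp_fip_image)
    fix I assume I: "finite I" "I \<subseteq> {F :: 'h set. finite F}"
    \<comment> \<open>\<open>S\<close> shrinks as its argument grows, so a point for the union
      serves every member of \<open>I\<close>.\<close>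
    then obtain p where p: "p \<in> S (\<Union>I)" using S_ne[of "\<Union>I"] by auto
    then have "p \<in> S F" if "F \<in> I" for F using that unfolding S_def by blast
    moreover have "p \<in> cball 0 M" using p M by (auto simp: S_def) (metis mult_1_right one_power2)
    ultimately show "cball 0 M \<inter> (\<Inter>F\<in>I. closure (S F)) \<noteq> {}"
      using closure_subset by blast
  qed auto
  then obtain \<xi> where \<xi>: "\<And>F. finite F \<Longrightarrow> \<xi> \<in> closure (S F)" by auto
  have "\<xi> \<in> ess_range A"
    unfolding ess_range_def
  proof (intro CollectI allI impI)
    fix F :: "'h set" and \<epsilon> :: real assume "finite F" "\<epsilon> > 0"
    then obtain p where "p \<in> S F" "dist p \<xi> < \<epsilon>" using \<xi> by (metis closure_approachable)
    then show "\<exists>y. norm y = 1 \<and> (\<forall>f\<in>F. cinner y f = 0) \<and> dist (quad A y) \<xi> < \<epsilon>"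
      unfolding S_def by blast
  qed
  moreover have "S {} \<subseteq> {p. b \<le> inner a p}" unfolding S_def by blast
  then have "closure (S {}) \<subseteq> {p. b \<le> inner a p}"
    by (intro closure_minimal) (simp_all add: closed_halfspace_ge)
  then have "b \<le> inner a \<xi>" using \<xi>[of "{}"] by blast
  ultimately show False using assms by fastforce
qed

text \<open>An empty essential range would satisfy even the absurd bound \<open>0 < - 1\<close>. The
  support lemma turns it into \<open>0 \<le> - (norm z)\<^sup>2\<close> for all \<open>z\<close>
  orthogonal to a finite set, which infinite dimension refutes.\<close>

lemma ess_range_nonempty: "ess_range A \<noteq> {}"
proof
  assume "ess_range A = {}"
  then obtain F where F: "finite F"
      "\<And>z. (\<And>f. f \<in> F \<Longrightarrow> cinner z f = 0) \<Longrightarrow> inner 0 (quad A z) \<le> (-1) * (norm z)\<^sup>2"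
    using ess_range_support[of 0 "-1"] by auto
  obtain y :: 'h where "norm y = 1" "\<And>f. f \<in> F \<Longrightarrow> cinner y f = 0"
    using unit_vector_orthogonal[OF infinite_dim F(1)] by blast
  then show False using F(2)[of y] by simp
qed

lemma ess_range_subset: "ess_range A \<subseteq> joint_ess_num_range A"
  unfolding joint_ess_num_range_def
proof (intro subsetI InterI)
  fix \<xi> S assume \<xi>: "\<xi> \<in> ess_range A"
    and "S \<in> {closure (joint_num_range 1 (\<lambda>j x. A j x + K j x)) | K. \<forall>j. compact_operator (K j)}"
  then obtain K where K: "\<And>j. compact_operator (K j)" and S: "S = closure (joint_num_range 1 (\<lambda>j x. A j x + K j x))"
    by blast
  have "\<exists>p\<in>joint_num_range 1 (\<lambda>j x. A j x + K j x). dist p \<xi> < \<epsilon>" if eps: "\<epsilon> > 0" for \<epsilon>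
  proof -
    \<comment> \<open>The coordinates of the perturbation together cost half of \<epsilon>; the
      other half goes to approximating \<xi>.\<close>
    define \<delta> where "\<delta> = \<epsilon> / (2 * CARD('m))"
    have "\<delta> > 0" using eps by (simp add: \<delta>_def)
    have "\<forall>j. \<exists>F. finite F \<and> (\<forall>y. norm y = 1 \<longrightarrow> (\<forall>f\<in>F. cinner y f = 0) \<longrightarrow> cmod (cinner (K j y) y) \<le> \<delta>)"
      using compact_operator_small_on_complement[OF K \<open>\<delta> > 0\<close>] by metis
    then obtain F where F: "\<And>j. finite (F j)"
        "\<And>j y. norm y = 1 \<Longrightarrow> (\<forall>f\<in>F j. cinner y f = 0) \<Longrightarrow> cmod (cinner (K j y) y) \<le> \<delta>"
      by metis
    have "finite (\<Union>j. F j)" using F(1) by simp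
    then obtain y where y: "norm y = 1" "\<forall>f\<in>(\<Union>j. F j). cinner y f = 0" "dist (quad A y) \<xi> < \<epsilon> / 2"
      using ess_rangeE[OF \<xi> _ half_gt_zero[OF eps]] by blast
    have "norm (quad K y) \<le> (\<Sum>j\<in>UNIV. norm (cinner (K j y) y))"
      using norm_vec_le_sum[of "quad K y"] by simp
    also have "\<dots> \<le> (\<Sum>j\<in>(UNIV::'m set). \<delta>)"
      using F(2)[OF y(1)] y(2) by (intro sum_mono) blast
    also have "\<dots> = \<epsilon> / 2" by (simp add: \<delta>_def)
    finally have "norm (quad K y) \<le> \<epsilon> / 2" .
    moreover have "quad (\<lambda>j x. A j x + K j x) y = quad A y + quad K y"
      by (simp add: vec_eq_iff cinner_distribs)
    ultimately have "dist (quad (\<lambda>j x. A j x + K j x) y) \<xi> < \<epsilon>"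
      using y(3) norm_triangle_ineq[of "quad A y - \<xi>" "quad K y"] by (simp add: dist_norm algebra_simps)
    then show ?thesis using y(1) unfolding joint_num_range_one by blast
  qed
  then show "\<xi> \<in> S" unfolding S by (simp add: closure_approachable)
qed

text \<open>A point outside \<open>ess_range A\<close> is cut off by a hyperplane, and one
  finite-rank perturbation moves the whole numerical range to the other side: compress
  \<open>A\<close> to the complement of the span of \<open>G\<close> and put the scalars
  \<open>c $ j\<close> on that span. The support lemma controls the first part, the choice of
  \<open>c\<close> in the essential range the second.\<close>

lemma joint_ess_num_range_subset: "joint_ess_num_range A \<subseteq> ess_range A"
proof
  fix \<xi> assume \<xi>: "\<xi> \<in> joint_ess_num_range A"
  show "\<xi> \<in> ess_range A"
  proof (rule ccontr)
    assume "\<xi> \<notin> ess_range A"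
    then obtain a' b' where "inner a' \<xi> < b'" "\<And>\<zeta>. \<zeta> \<in> ess_range A \<Longrightarrow> inner a' \<zeta> > b'"
      using separating_hyperplane_closed_point[OF convex_ess_range closed_ess_range] by metis
    \<comment> \<open>Separation bounds the set from below, \<open>ess_range_support\<close> bounds
      the forms from above; hence the change of sign.\<close>
    moreover define a b where "a = - a'" "b = - b'"
    ultimately have ab: "inner a \<xi> > b" "\<And>\<zeta>. \<zeta> \<in> ess_range A \<Longrightarrow> inner a \<zeta> < b"
      by simp_all
    obtain F where F: "finite F" "\<And>z. (\<And>f. f \<in> F \<Longrightarrow> cinner z f = 0) \<Longrightarrow> inner a (quad A z) \<le> b * (norm z)\<^sup>2"
      using ess_range_support[of a b] ab(2) by blast
    obtain G where G: "finite G" "orthonormal_on G (\<lambda>x. x)" "F \<subseteq> cspan G"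
      using orthonormal_set_extend[OF F(1)] .
    obtain c where c: "c \<in> ess_range A" using ess_range_nonempty by blast
    define Q where "Q x = (\<Sum>g\<in>G. cinner x g *\<^sub>C g)" for x
    \<comment> \<open>This is \<open>c $ j\<close> times \<open>Q\<close>, minus
      \<open>A j Q\<close>, plus \<open>Q A j Q\<close>, minus \<open>Q A j\<close>, with
      \<open>Q\<close> expanded over \<open>G\<close> so that compactness can be read off from
      rank-one terms.\<close>
    define K where "K j x = (\<Sum>g\<in>G. cinner x g *\<^sub>C (c $ j *\<^sub>C g - A j g + Q (A j g)) + cinner x (A j g) *\<^sub>C (- g))" for j x
    have "compact_operator (K j)" for j
      unfolding K_def by (intro compact_operator_sum G compact_operator_add compact_operator_rank_one)
    then have mem: "\<xi> \<in> closure (joint_num_range 1 (\<lambda>j x. A j x + K j x))"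
      using \<xi> unfolding joint_ess_num_range_def by blast
    have Q_span: "Q x \<in> cspan G" for x
      unfolding Q_def by (intro complex_vector.span_sum complex_vector.span_scale complex_vector.span_base)
    have Q_orth: "cinner (x - Q x) y = 0" if "y \<in> cspan G" for x y
      unfolding Q_def by (rule cinner_eq_zero_of_span[OF bessel_orthogonal[OF G(2,1)] that])
    have Q_lin: "Q (x - y) = Q x - Q y" "Q (\<Sum>i\<in>I. f i *\<^sub>C h i) = (\<Sum>i\<in>I. f i *\<^sub>C Q (h i))" for x y f h and I :: "'h set"
      unfolding Q_def cinner_distribs
       apply (simp add: complex_vector.scale_left_diff_distrib sum_subtractf)
      unfolding complex_vector.scale_sum_left complex_vector.scale_sum_right complex_vector.scale_scale
      by (rule sum.swap)
    have AK: "A j x + K j x = A j (x - Q x) - Q (A j (x - Q x)) + c $ j *\<^sub>C Q x" for j x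
    proof -
      have 1: "A j (Q x) = (\<Sum>g\<in>G. cinner x g *\<^sub>C A j g)"
        unfolding Q_def by (simp add: A_simps)
      have 2: "Q (A j x) = (\<Sum>g\<in>G. cinner x (A j g) *\<^sub>C g)"
        unfolding Q_def by (simp add: adjoint)
      have 3: "Q (A j (Q x)) = (\<Sum>g\<in>G. cinner x g *\<^sub>C Q (A j g))"
        unfolding 1 by (rule Q_lin)
      have 4: "c $ j *\<^sub>C Q x = (\<Sum>g\<in>G. cinner x g *\<^sub>C (c $ j *\<^sub>C g))"
        unfolding Q_def complex_vector.scale_sum_right by (simp add: mult.commute)
      have "K j x = c $ j *\<^sub>C Q x - A j (Q x) + Q (A j (Q x)) - Q (A j x)"
        unfolding 2 3 4 unfolding 1 K_def
        by (simp add: complex_vector.scale_right_distrib complex_vector.scale_right_diff_distrib sum.distrib sum_subtractf sum_negf)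
      then show ?thesis by (simp add: A_simps Q_lin)
    qed
    have quad_AK: "quad (\<lambda>j x. A j x + K j x) x = quad A (x - Q x) + (norm (Q x))\<^sup>2 *\<^sub>R c" for x
    proof -
      define r where "r = x - Q x"
      define q where "q = Q x"
      have x: "x = r + q" by (simp add: r_def q_def)
      have r_orth: "cinner y r = 0" if "y \<in> cspan G" for y
        using Q_orth[OF that, of x] cinner_eq_zero_commute[of y r] by (simp add: r_def)
      have "cinner (A j x + K j x) x = cinner (A j r) r + of_real ((norm q)\<^sup>2) * c $ j" for j
      proof -
        have 1: "cinner (A j r - Q (A j r)) q = 0" by (rule Q_orth) (simp add: q_def Q_span)
        have 2: "cinner (Q (A j r)) r = 0" "cinner q r = 0" using r_orth Q_span by (simp_all add: q_def)
        have "cinner (A j x + K j x) x = cinner (A j r - Q (A j r) + c $ j *\<^sub>C q) (r + q)"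
          unfolding AK by (simp add: r_def q_def)
        also have "\<dots> = cinner (A j r - Q (A j r)) r + cinner (A j r - Q (A j r)) q + c $ j * (cinner q r + cinner q q)"
          unfolding cinner_add_left cinner_add_right cinner_scaleC_left by (simp add: algebra_simps)
        also have "\<dots> = cinner (A j r) r + of_real ((norm q)\<^sup>2) * c $ j"
          unfolding 1 using 2 by (simp add: cinner_diff_left cinner_self)
        finally show ?thesis .
      qed
      then show ?thesis by (simp add: vec_eq_iff r_def q_def) (simp add: scaleR_conv_of_real)
    qed
    have "joint_num_range 1 (\<lambda>j x. A j x + K j x) \<subseteq> {p. inner a p \<le> b}"
    proof
      fix p assume "p \<in> joint_num_range 1 (\<lambda>j x. A j x + K j x)"
      then obtain x where x: "norm x = 1" "p = quad A (x - Q x) + (norm (Q x))\<^sup>2 *\<^sub>R c"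
        unfolding joint_num_range_one quad_AK by blast
      have "inner a (quad A (x - Q x)) \<le> b * (norm (x - Q x))\<^sup>2"
        using Q_orth G(3) by (intro F(2)) blast
      moreover have "(norm (Q x))\<^sup>2 * inner a c \<le> b * (norm (Q x))\<^sup>2"
        using ab(2)[OF c] by (subst mult.commute) (intro mult_right_mono, auto)
      moreover have "(norm (x - Q x))\<^sup>2 + (norm (Q x))\<^sup>2 = 1"
        using pythagoras[OF Q_orth[OF Q_span[of x], of x]] x(1) by simp
      then have "b * (norm (x - Q x))\<^sup>2 + b * (norm (Q x))\<^sup>2 = b"
        by (metis distrib_left mult_1_right)
      ultimately show "p \<in> {p. inner a p \<le> b}"
        by (simp add: x inner_add_right)
    qed
    then have "closure (joint_num_range 1 (\<lambda>j x. A j x + K j x)) \<subseteq> {p. inner a p \<le> b}"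
      by (intro closure_minimal) (simp_all add: closed_halfspace_le)
    then show False using mem ab(1) by fastforce
  qed
qed

lemma joint_ess_num_range_eq: "joint_ess_num_range A = ess_range A"
  using ess_range_subset joint_ess_num_range_subset by blast

end

section \<open>Compressions\<close>

lemma orthonormal_family_expansion:
  assumes "finite I" "orthonormal_on I e" "x \<in> cspan (e ` I)"
  shows "x = (\<Sum>i\<in>I. cinner x (e i) *\<^sub>C e i)"
proof -
  let ?r = "x - (\<Sum>i\<in>I. cinner x (e i) *\<^sub>C e i)"
  have "?r \<in> cspan (e ` I)"
    by (intro complex_vector.span_diff assms complex_vector.span_sum complex_vector.span_scale complex_vector.span_base) auto
  moreover have "cinner ?r f = 0" if "f \<in> e ` I" for f
    using bessel_orthogonal[OF assms(2,1)] that by blast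
  ultimately have "cinner ?r ?r = 0" using cinner_eq_zero_of_span by blast
  then show ?thesis by (simp add: cinner_self)
qed

lemma bounded_clinear_compose:
  "bounded_clinear S \<Longrightarrow> bounded_clinear T \<Longrightarrow> bounded_clinear (\<lambda>x. S (T x))"
  by (auto simp: bounded_clinear_def intro: bounded_linear_compose)

text \<open>The map sending \<open>a\<close> to \<open>\<Sum>l<k. a l *\<^sub>C u l\<close> is a
  contraction, that is, the Gram matrix is at most the identity. In this form the condition passes
  to weak limits and to components of orthonormal families.\<close>

definition contractive_family :: "nat \<Rightarrow> (nat \<Rightarrow> 'a::complex_inner) \<Rightarrow> bool" where
  "contractive_family k u \<longleftrightarrow>
    (\<forall>a. (norm (\<Sum>l<k. a l *\<^sub>C u l))\<^sup>2 \<le> (\<Sum>l<k. (cmod (a l))\<^sup>2))"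

lemma cinner_sum_pair:
  "cinner (\<Sum>l\<in>I. cinner x (u l) *\<^sub>C w l) y = (\<Sum>l\<in>I. cinner x (u l) * cinner (w l) y)"
  by (simp add: cinner_distribs)

lemma cinner_mult_commute_self: "cinner x y * cinner y x = of_real ((cmod (cinner x y))\<^sup>2)"
  using mult_cnj_self(1)[of "cinner x y"] cinner_commute[of y x] by simp

text \<open>If \<open>T\<close> sends \<open>a\<close> to
  \<open>\<Sum>l<k. a l *\<^sub>C u l\<close>, the frame operator is \<open>T T\<^sup>*\<close> and
  the Gram matrix corresponds to \<open>T\<^sup>* T\<close>; one is at most the identity iff the
  other is. From left to right, with \<open>w = T a\<close>, this amounts to bounding
  \<open>(norm w)\<^sup>2\<close> by the mean of itself and the squared norm of
  \<open>a\<close>.\<close>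

lemma contraction_frame_iff:
  fixes u :: "nat \<Rightarrow> 'a::complex_inner"
  shows "contraction (\<lambda>x. \<Sum>l<k. cinner x (u l) *\<^sub>C u l) \<longleftrightarrow> contractive_family k u"
proof
  let ?P = "\<lambda>x. \<Sum>l<k. cinner x (u l) *\<^sub>C u l"
  have P: "cinner (?P x) x = of_real (\<Sum>l<k. (cmod (cinner x (u l)))\<^sup>2)" for x
    unfolding cinner_sum_pair cinner_mult_commute_self by simp
  assume contr: "contraction ?P"
  show "contractive_family k u"
    unfolding contractive_family_def
  proof
    fix a :: "nat \<Rightarrow> complex"
    define w where "w = (\<Sum>l<k. a l *\<^sub>C u l)"
    define s where "s = (\<Sum>l<k. (cmod (cinner w (u l)))\<^sup>2)"
    have "s = Re (cinner (?P w) w)" unfolding P s_def by simp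
    also have "\<dots> \<le> norm (?P w) * norm w"
      using norm_cauchy_schwarz[of "?P w" w] by (simp only: Re_cinner)
    also have "\<dots> \<le> norm w * norm w"
      using contr by (intro mult_right_mono) (auto simp: contraction_def)
    finally have s: "s \<le> (norm w)\<^sup>2" by (simp add: power2_eq_square)
    have "(norm w)\<^sup>2 = Re (cinner w w)" by (simp add: cinner_self)
    also have "cinner w w = (\<Sum>l<k. a l * cinner (u l) w)"
      by (subst w_def) (simp add: cinner_distribs)
    also have "Re \<dots> \<le> (\<Sum>l<k. ((cmod (a l))\<^sup>2 + (cmod (cinner w (u l)))\<^sup>2) / 2)"
      unfolding Re_sum
    proof (rule sum_mono)
      fix l
      have "Re (a l * cinner (u l) w) \<le> cmod (a l) * cmod (cinner (u l) w)"
        using complex_Re_le_cmod[of "a l * cinner (u l) w"] by (simp add: norm_mult)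
      also have "cmod (cinner (u l) w) = cmod (cinner w (u l))"
        by (metis cinner_commute complex_mod_cnj)
      also have "cmod (a l) * cmod (cinner w (u l)) \<le> ((cmod (a l))\<^sup>2 + (cmod (cinner w (u l)))\<^sup>2) / 2"
        using sum_squares_bound[of "cmod (a l)" "cmod (cinner w (u l))"] by simp
      finally show "Re (a l * cinner (u l) w) \<le> ((cmod (a l))\<^sup>2 + (cmod (cinner w (u l)))\<^sup>2) / 2" .
    qed
    also have "\<dots> = ((\<Sum>l<k. (cmod (a l))\<^sup>2) + s) / 2"
      by (simp add: s_def sum.distrib flip: sum_divide_distrib)
    finally show "(norm (\<Sum>l<k. a l *\<^sub>C u l))\<^sup>2 \<le> (\<Sum>l<k. (cmod (a l))\<^sup>2)"
      using s by (simp add: w_def[symmetric])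
  qed
next
  let ?P = "\<lambda>x. \<Sum>l<k. cinner x (u l) *\<^sub>C u l"
  assume u: "contractive_family k u"
  have "norm (?P x) \<le> norm x" for x
  proof -
    have "(norm (?P x))\<^sup>2 \<le> (\<Sum>l<k. (cmod (cinner x (u l)))\<^sup>2)"
      using u unfolding contractive_family_def by (rule spec)
    also have "\<dots> = Re (cinner (?P x) x)"
      unfolding cinner_sum_pair cinner_mult_commute_self by simp
    also have "\<dots> \<le> norm (?P x) * norm x"
      using norm_cauchy_schwarz[of "?P x" x] by (simp only: Re_cinner)
    finally have "norm (?P x) * norm (?P x) \<le> norm (?P x) * norm x" by (simp add: power2_eq_square)
    then show ?thesis by (cases "norm (?P x) = 0") (auto simp: mult_le_cancel_left)
  qed
  then show "contraction ?P"
    unfolding contraction_def by (intro conjI allI bounded_clinear_sum bounded_clinear_rank_one)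
qed

lemma positive_semidefinite_frame:
  "positive_semidefinite (\<lambda>x. \<Sum>l<k. cinner x (u l) *\<^sub>C u l)"
  unfolding positive_semidefinite_def selfadjoint_def
proof (intro conjI allI)
  let ?P = "\<lambda>x. \<Sum>l<k. cinner x (u l) *\<^sub>C u l"
  show "bounded_clinear ?P" by (intro bounded_clinear_sum bounded_clinear_rank_one)
  show "cinner (?P x) y = cinner x (?P y)" for x y
    unfolding cinner_distribs using cinner_commute[of "u _" y] by (intro sum.cong) (auto simp: mult.commute)
  show "0 \<le> Re (cinner (?P x) x)" for x
    unfolding cinner_sum_pair cinner_mult_commute_self by (simp add: sum_nonneg)
qed

lemma rank_at_most_frame: "rank_at_most k (\<lambda>x. \<Sum>l<k. cinner x (u l) *\<^sub>C w l)"
  unfolding rank_at_most_def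
proof (intro exI conjI)
  show "card (w ` {..<k}) \<le> k" using card_image_le[of "{..<k}" w] by simp
  show "range (\<lambda>x. \<Sum>l<k. cinner x (u l) *\<^sub>C w l) \<subseteq> cspan (w ` {..<k})"
  proof clarify
    show "(\<Sum>l<k. cinner x (u l) *\<^sub>C w l) \<in> cspan (w ` {..<k})" for x
      by (intro complex_vector.span_sum complex_vector.span_scale complex_vector.span_base) auto
  qed
qed simp

text \<open>The orthonormal family \<open>f\<close> only serves to view the defect of the Gram matrix of \<open>u\<close> as an
  operator, to which the Cholesky decomposition applies.\<close>

lemma contractive_family_defect:
  fixes u f :: "nat \<Rightarrow> 'a::complex_inner"
  assumes u: "contractive_family k u" and f: "orthonormal_on {..<k} f"
  obtains V where "\<And>l m. l < k \<Longrightarrow> m < k \<Longrightarrow>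
    cinner (u l) (u m) + (\<Sum>c<k. V l c * cnj (V m c)) = (if l = m then 1 else 0)"
proof -
  define T where "T y = (\<Sum>l<k. cinner y (f l) *\<^sub>C u l)" for y
  \<comment> \<open>The projection onto the span of the \<open>f l\<close>, minus
    \<open>T\<^sup>* T\<close>. In the basis \<open>f\<close> its matrix is the identity minus the
    Gram matrix of \<open>u\<close>.\<close>
  define R where "R y = (\<Sum>l<k. cinner y (f l) *\<^sub>C f l) - (\<Sum>l<k. cinner (T y) (u l) *\<^sub>C f l)" for y
  have RT: "cinner (R x) y = (\<Sum>l<k. cinner x (f l) * cinner (f l) y) - cinner (T x) (T y)" for x y
  proof -
    have "cinner (T x) (T y) = (\<Sum>l<k. cinner (T x) (u l) * cinner (f l) y)"
      unfolding T_def[of y] cinner_distribs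
      using cinner_commute[of "f _" y] by (intro sum.cong) (auto simp: mult.commute)
    then show ?thesis unfolding R_def cinner_diff_left cinner_sum_pair by simp
  qed
  have "cinner (R x) y = cinner x (R y)" for x y
  proof -
    have "cinner x (R y) = cnj (cinner (R y) x)" by (rule cinner_commute)
    also have "\<dots> = (\<Sum>l<k. cinner (f l) y * cinner x (f l)) - cinner (T x) (T y)"
      unfolding RT using cinner_commute[of "T x" "T y"] cinner_commute[of "f _" y] cinner_commute[of x "f _"]
      by simp
    finally show ?thesis unfolding RT by (simp add: mult.commute)
  qed
  moreover have "bounded_clinear R"
    unfolding R_def
    by (intro bounded_clinear_diff bounded_clinear_sum bounded_clinear_rank_one
        bounded_clinear_compose[OF bounded_clinear_rank_one, of T])
      (unfold T_def, intro bounded_clinear_sum bounded_clinear_rank_one)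
  moreover have "0 \<le> Re (cinner (R x) x)" for x
    using u unfolding RT cinner_mult_commute_self cinner_self contractive_family_def
    by (simp add: T_def flip: of_real_diff of_real_sum)
  ultimately have "positive_semidefinite R"
    by (simp add: positive_semidefinite_def selfadjoint_def)
  moreover have "rank_at_most k R"
  proof -
    have "R y \<in> cspan (f ` {..<k})" for y
      unfolding R_def
      by (intro complex_vector.span_diff complex_vector.span_sum complex_vector.span_scale complex_vector.span_base) auto
    then show ?thesis
      unfolding rank_at_most_def using card_image_le[of "{..<k}" f]
      by (intro exI[of _ "f ` {..<k}"]) auto
  qed
  ultimately obtain z where z: "\<And>x. R x = (\<Sum>c<k. cinner x (z c) *\<^sub>C z c)"
    using positive_semidefinite_cholesky by blast
  have ff: "cinner (f l) (f m) = (if l = m then 1 else 0)" if "l < k" "m < k" for l m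
    using f that by (auto simp: orthonormal_on_def)
  have Tf: "T (f l) = u l" if "l < k" for l
  proof -
    have "T (f l) = (\<Sum>m<k. if l = m then u m else 0)"
      unfolding T_def using ff that by (intro sum.cong) auto
    then show ?thesis using that by simp
  qed
  \<comment> \<open>\<open>V\<close> collects the coordinates of the Cholesky vectors
    \<open>z c\<close> with respect to \<open>f\<close>.\<close>
  have "cinner (u l) (u m) + (\<Sum>c<k. cinner (f l) (z c) * cnj (cinner (f m) (z c))) = (if l = m then 1 else 0)"
    if "l < k" "m < k" for l m
  proof -
    have "(\<Sum>c<k. cinner (f l) (z c) * cnj (cinner (f m) (z c))) = cinner (R (f l)) (f m)"
      unfolding z cinner_sum_pair cinner_commute[of "z _" "f m"] ..
    also have "\<dots> = (\<Sum>i<k. if i = l then (if l = m then 1 else 0) else 0) - cinner (u l) (u m)"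
      unfolding RT Tf[OF that(1)] Tf[OF that(2)]
      using ff that by (intro arg_cong2[of _ _ _ _ minus] sum.cong) auto
    finally show ?thesis using that by simp
  qed
  then show ?thesis using that[of "\<lambda>l c. cinner (f l) (z c)"] by blast
qed

text \<open>Taking traces in the Gram identity: the total weight of \<open>V\<close> is the
  coefficient of \<xi> in \<open>compression_range\<close>.\<close>

lemma defect_norm_sum:
  assumes "\<And>l m. l < k \<Longrightarrow> m < k \<Longrightarrow>
    cinner (u l) (u m) + (\<Sum>c<k. V l c * cnj (V m c)) = (if l = m then 1 else 0)"
  shows "(\<Sum>l<k. \<Sum>c<k. (cmod (V l c))\<^sup>2) = real k - (\<Sum>l<k. (norm (u l))\<^sup>2)"
proof -
  have "(\<Sum>c<k. (cmod (V l c))\<^sup>2) = 1 - (norm (u l))\<^sup>2" if "l < k" for l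
  proof -
    have "complex_of_real ((norm (u l))\<^sup>2 + (\<Sum>c<k. (cmod (V l c))\<^sup>2)) = of_real 1"
      using assms[OF that that] by (simp add: cinner_self mult_cnj_self)
    then show ?thesis unfolding of_real_eq_iff by linarith
  qed
  then have "(\<Sum>l<k. \<Sum>c<k. (cmod (V l c))\<^sup>2) = (\<Sum>l<k. 1 - (norm (u l))\<^sup>2)"
    by (intro sum.cong) auto
  then show ?thesis by (simp add: sum_subtractf)
qed

definition compression_range :: "nat \<Rightarrow> ('m::finite \<Rightarrow> 'a::complex_inner \<Rightarrow> 'a) \<Rightarrow> (complex ^ 'm) set" where
  "compression_range k A = {(\<Sum>l<k. quad A (u l)) + (real k - (\<Sum>l<k. (norm (u l))\<^sup>2)) *\<^sub>R \<xi> | u \<xi>.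
    contractive_family k u \<and> \<xi> \<in> ess_range A}"

section \<open>The closure of the joint k-numerical range\<close>

context selfadjoint_tuple
begin

text \<open>Padding with zero vectors lets the Cholesky decomposition of an operator of rank at most
  \<open>k\<close> always be indexed by \<open>{..<k}\<close>, so operators and families
  match.\<close>

lemma compression_range_trace:
  "compression_range k A =
    {(\<chi> j. op_trace (\<lambda>x. A j (P x))) + (of_nat k - op_trace P) *s \<xi> | P \<xi>.
      positive_semidefinite P \<and> contraction P \<and> rank_at_most k P \<and> \<xi> \<in> ess_range A}"
proof -
  have eq: "(\<chi> j. op_trace (\<lambda>x. A j (\<Sum>l<k. cinner x (u l) *\<^sub>C u l))) +
        (of_nat k - op_trace (\<lambda>x. \<Sum>l<k. cinner x (u l) *\<^sub>C u l)) *s \<xi>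
      = (\<Sum>l<k. quad A (u l)) + (real k - (\<Sum>l<k. (norm (u l))\<^sup>2)) *\<^sub>R \<xi>" for u \<xi>
    by (simp add: vec_eq_iff A_simps op_trace_finite_rank cinner_self)
      (simp add: scaleR_conv_of_real left_diff_distrib)
  show ?thesis
  proof (intro subset_antisym subsetI)
    fix p assume "p \<in> compression_range k A"
    then obtain u \<xi> where p: "p = (\<Sum>l<k. quad A (u l)) + (real k - (\<Sum>l<k. (norm (u l))\<^sup>2)) *\<^sub>R \<xi>"
      and u: "contractive_family k u" and \<xi>: "\<xi> \<in> ess_range A"
      unfolding compression_range_def by blast
    have "contraction (\<lambda>x. \<Sum>l<k. cinner x (u l) *\<^sub>C u l)" using u contraction_frame_iff by blast
    then show "p \<in> {(\<chi> j. op_trace (\<lambda>x. A j (P x))) + (of_nat k - op_trace P) *s \<xi> | P \<xi>.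
      positive_semidefinite P \<and> contraction P \<and> rank_at_most k P \<and> \<xi> \<in> ess_range A}"
      unfolding p eq[symmetric]
      by (intro CollectI exI[of _ "\<lambda>x. \<Sum>l<k. cinner x (u l) *\<^sub>C u l"] exI[of _ \<xi>] conjI refl \<xi>
          positive_semidefinite_frame rank_at_most_frame)
  next
    fix p assume "p \<in> {(\<chi> j. op_trace (\<lambda>x. A j (P x))) + (of_nat k - op_trace P) *s \<xi> | P \<xi>.
      positive_semidefinite P \<and> contraction P \<and> rank_at_most k P \<and> \<xi> \<in> ess_range A}"
    then obtain P \<xi> where p: "p = (\<chi> j. op_trace (\<lambda>x. A j (P x))) + (of_nat k - op_trace P) *s \<xi>"
      and P: "positive_semidefinite P" "contraction P" "rank_at_most k P" and \<xi>: "\<xi> \<in> ess_range A"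
      by blast
    obtain u where u: "P = (\<lambda>x. \<Sum>l<k. cinner x (u l) *\<^sub>C u l)"
      using positive_semidefinite_cholesky[OF P(1,3)] by blast
    have "contractive_family k u" using P(2) contraction_frame_iff unfolding u by blast
    then show "p \<in> compression_range k A"
      using \<xi> unfolding compression_range_def p u eq by blast
  qed
qed

text \<open>Orthogonality to the earlier vectors and to their images under all \<open>A j\<close>
  removes the cross terms, so the forms of a linear combination are the sums of those of its
  terms.\<close>

lemma ess_range_sequence:
  assumes "\<xi> \<in> ess_range A" "finite F" "\<epsilon> > 0"
  shows "\<exists>y :: nat \<Rightarrow> 'h. \<forall>c<k. norm (y c) = 1 \<and> (\<forall>f\<in>F. cinner (y c) f = 0) \<and> dist (quad A (y c)) \<xi> < \<epsilon> \<and>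
    (\<forall>b<c. cinner (y c) (y b) = 0 \<and> (\<forall>j. cinner (y c) (A j (y b)) = 0))"
proof (induction k)
  case (Suc k)
  then obtain y :: "nat \<Rightarrow> 'h" where y: "\<forall>c<k. norm (y c) = 1 \<and> (\<forall>f\<in>F. cinner (y c) f = 0) \<and> dist (quad A (y c)) \<xi> < \<epsilon> \<and>
    (\<forall>b<c. cinner (y c) (y b) = 0 \<and> (\<forall>j. cinner (y c) (A j (y b)) = 0))"
    by blast
  let ?F = "F \<union> y ` {..<k} \<union> (\<Union>j. (\<lambda>b. A j (y b)) ` {..<k})"
  have F: "finite ?F" using assms(2) by simp
  obtain z where z: "norm z = 1" "\<forall>f\<in>?F. cinner z f = 0" "dist (quad A z) \<xi> < \<epsilon>"
    using ess_rangeE[OF assms(1) F assms(3)] .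
  have zF: "\<forall>f\<in>F. cinner z f = 0" "\<forall>b<k. cinner z (y b) = 0" "\<forall>b<k. \<forall>j. cinner z (A j (y b)) = 0"
    using z(2) by blast+
  have "\<forall>c<Suc k. norm ((y(k := z)) c) = 1 \<and> (\<forall>f\<in>F. cinner ((y(k := z)) c) f = 0) \<and> dist (quad A ((y(k := z)) c)) \<xi> < \<epsilon> \<and>
    (\<forall>b<c. cinner ((y(k := z)) c) ((y(k := z)) b) = 0 \<and> (\<forall>j. cinner ((y(k := z)) c) (A j ((y(k := z)) b)) = 0))"
    using y z(1,3) zF by (simp add: less_Suc_eq)
  then show ?case by (rule exI[of _ "y(k := z)"])
qed simp

text \<open>Supplies the auxiliary family for \<open>contractive_family_defect\<close>; the
  recursion above with empty \<open>F\<close> already yields one.\<close>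

lemma orthonormal_family_exists: obtains f :: "nat \<Rightarrow> 'h" where "orthonormal_on {..<k} f"
proof -
  obtain \<xi> where \<xi>: "\<xi> \<in> ess_range A" using ess_range_nonempty by blast
  have "\<exists>f :: nat \<Rightarrow> 'h. \<forall>c<k. norm (f c) = 1 \<and> (\<forall>b<c. cinner (f c) (f b) = 0)"
    by (rule ex_forward[OF ess_range_sequence[OF \<xi> finite.emptyI zero_less_one]]) blast
  then obtain f :: "nat \<Rightarrow> 'h" where f: "\<forall>c<k. norm (f c) = 1 \<and> (\<forall>b<c. cinner (f c) (f b) = 0)"
    by blast
  have "cinner (f b) (f c) = 0" if "b < k" "c < k" "b \<noteq> c" for b c
    using that f cinner_eq_zero_commute[of "f b" "f c"] by (metis linorder_neqE_nat)
  then have "orthonormal_on {..<k} f"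
    using f by (simp add: orthonormal_on_def cinner_self_eq_one)
  then show ?thesis by (rule that)
qed

lemma quad_sum_orthogonal:
  assumes "finite I" "\<And>i i' j. i \<in> I \<Longrightarrow> i' \<in> I \<Longrightarrow> i \<noteq> i' \<Longrightarrow> cinner (A j (y i)) (y i') = 0"
  shows "quad A (\<Sum>i\<in>I. y i) = (\<Sum>i\<in>I. quad A (y i))"
  using assms
proof (induction I rule: finite_induct)
  case (insert i I)
  have "quad A (y i + (\<Sum>i\<in>I. y i)) = quad A (y i) + quad A (\<Sum>i\<in>I. y i)"
    using insert by (intro quad_add_orthogonal) (auto simp: cinner_sum_right intro!: sum.neutral)
  then show ?case using insert by simp
qed simp

lemma compression_range_subset_closure: "compression_range k A \<subseteq> closure (joint_num_range k A)"
proof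
  fix p assume "p \<in> compression_range k A"
  then obtain u \<xi> where p: "p = (\<Sum>l<k. quad A (u l)) + (real k - (\<Sum>l<k. (norm (u l))\<^sup>2)) *\<^sub>R \<xi>"
      and u: "contractive_family k u" and \<xi>: "\<xi> \<in> ess_range A"
    unfolding compression_range_def by blast
  obtain f :: "nat \<Rightarrow> 'h" where f: "orthonormal_on {..<k} f" using orthonormal_family_exists .
  obtain V where V: "\<And>l m. l < k \<Longrightarrow> m < k \<Longrightarrow>
      cinner (u l) (u m) + (\<Sum>c<k. V l c * cnj (V m c)) = (if l = m then 1 else 0)"
    using contractive_family_defect[OF u f] by blast
  have Vsum: "(\<Sum>l<k. \<Sum>c<k. (cmod (V l c))\<^sup>2) = real k - (\<Sum>l<k. (norm (u l))\<^sup>2)"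
    using V by (rule defect_norm_sum)
  have "\<exists>q\<in>joint_num_range k A. dist q p < \<epsilon>" if eps: "\<epsilon> > 0" for \<epsilon>
  proof -
    \<comment> \<open>The errors carry total weight at most \<open>k\<close>; the \<open>+ 1\<close>
      makes the final estimate strict and covers \<open>k = 0\<close>.\<close>
    define \<delta> where "\<delta> = \<epsilon> / (real k + 1)"
    have \<delta>: "\<delta> > 0" using eps by (simp add: \<delta>_def)
    \<comment> \<open>Avoiding the \<open>u l\<close> makes the Gram matrices add; avoiding the
      \<open>A j (u l)\<close> makes the forms add.\<close>
    let ?F = "u ` {..<k} \<union> (\<Union>j. (\<lambda>l. A j (u l)) ` {..<k})"
    have F: "finite ?F" by simp
    obtain y :: "nat \<Rightarrow> 'h" where y: "\<forall>c<k. norm (y c) = 1 \<and> (\<forall>f\<in>?F. cinner (y c) f = 0) \<and> dist (quad A (y c)) \<xi> < \<delta> \<and>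
        (\<forall>b<c. cinner (y c) (y b) = 0 \<and> (\<forall>j. cinner (y c) (A j (y b)) = 0))"
      using ess_range_sequence[OF \<xi> F \<delta>, of k] by (rule exE)
    have yy: "cinner (y b) (y c) = (if b = c then 1 else 0)" "b \<noteq> c \<Longrightarrow> cinner (A j (y b)) (y c) = 0"
      if "b < k" "c < k" for b c j
    proof -
      have "cinner (y b) (y c) = 0 \<and> cinner (A j (y b)) (y c) = 0" if "b \<noteq> c"
        using y \<open>b < k\<close> \<open>c < k\<close> that cinner_eq_zero_commute[of "y b" "y c"]
          cinner_eq_zero_commute[of "A j (y b)" "y c"] adjoint[of j "y b" "y c"]
        by (metis linorder_neqE_nat)
      then show "cinner (y b) (y c) = (if b = c then 1 else 0)" "b \<noteq> c \<Longrightarrow> cinner (A j (y b)) (y c) = 0"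
        using y that by (auto simp: cinner_self_eq_one)
    qed
    define v where "v l = (\<Sum>c<k. V l c *\<^sub>C y c)" for l
    define x where "x l = u l + v l" for l
    have yu: "cinner (y c) (u l) = 0" "cinner (u l) (y c) = 0" "cinner (A j (u l)) (y c) = 0"
      if "l < k" "c < k" for l c j
    proof -
      have "u l \<in> ?F" "A j (u l) \<in> ?F" using that(1) by auto
      then have "cinner (y c) (u l) = 0 \<and> cinner (y c) (A j (u l)) = 0" using y that(2) by blast
      then show "cinner (y c) (u l) = 0" "cinner (u l) (y c) = 0" "cinner (A j (u l)) (y c) = 0"
        using cinner_eq_zero_commute[of "y c"] by auto
    qed
    have vu: "cinner (v m) (u l) = 0" "cinner (u l) (v m) = 0" "cinner (A j (u l)) (v m) = 0"
      if "l < k" for l m j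
      unfolding v_def cinner_sum_left cinner_sum_right cinner_scaleC_left cinner_scaleC_right
      by (rule sum.neutral, use yu[OF that] in simp)+
    have vv: "cinner (v l) (v m) = (\<Sum>c<k. V l c * cnj (V m c))" for l m
    proof -
      have "cinner (v l) (v m) = (\<Sum>c<k. \<Sum>b<k. if b = c then V l b * cnj (V m c) else 0)"
        unfolding v_def cinner_distribs sum_distrib_left using yy(1) by (intro sum.cong) (auto simp: mult.commute)
      then show ?thesis by simp
    qed
    have "orthonormal_on {..<k} x"
      unfolding orthonormal_on_def x_def
      using V vv vu by (simp add: cinner_add_left cinner_add_right)
    then have mem: "(\<Sum>l<k. quad A (x l)) \<in> joint_num_range k A"
      unfolding joint_num_range_quad by blast
    have quad_v: "quad A (v l) = (\<Sum>c<k. (cmod (V l c))\<^sup>2 *\<^sub>R quad A (y c))" for l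
      unfolding v_def using yy(2)
      by (subst quad_sum_orthogonal) (auto simp: A_simps cinner_distribs quad_scaleC)
    have "(\<Sum>l<k. quad A (x l)) - p = (\<Sum>l<k. quad A (v l)) - (\<Sum>l<k. \<Sum>c<k. (cmod (V l c))\<^sup>2) *\<^sub>R \<xi>"
      unfolding p x_def Vsum using vu(3) by (simp add: quad_add_orthogonal sum.distrib)
    also have "\<dots> = (\<Sum>l<k. \<Sum>c<k. (cmod (V l c))\<^sup>2 *\<^sub>R (quad A (y c) - \<xi>))"
      by (simp add: quad_v scaleR_diff_right sum_subtractf scaleR_sum_left)
    also have "norm \<dots> \<le> (\<Sum>l<k. \<Sum>c<k. (cmod (V l c))\<^sup>2 * \<delta>)"
      using y by (intro order_trans[OF norm_sum] sum_mono)
        (auto simp: dist_norm intro!: mult_left_mono intro: less_imp_le)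
    also have "\<dots> = (real k - (\<Sum>l<k. (norm (u l))\<^sup>2)) * \<delta>"
      unfolding Vsum[symmetric] by (simp add: sum_distrib_right)
    also have "\<dots> \<le> real k * \<delta>"
      using \<delta> by (intro mult_right_mono) (auto simp: sum_nonneg)
    also have "\<dots> < \<epsilon>" using eps by (simp add: \<delta>_def field_simps)
    finally show ?thesis using mem by (auto simp: dist_norm)
  qed
  then show "p \<in> closure (joint_num_range k A)" by (simp add: closure_approachable)
qed

text \<open>A weakly null sequence is asymptotically orthogonal to any finite set: its projection
  \<open>q n\<close> onto the span of \<open>G\<close> has finitely many coefficients, each tending
  to 0. The support bound applies to \<open>y n - q n\<close>, and the correction is the error
  term.\<close>

lemma tendsto_weak_null_support:
  assumes weak: "\<And>g. (\<lambda>n. cinner (y n) g) \<longlonglongrightarrow> 0" and F: "finite F"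
    and le: "\<And>z. (\<And>f. f \<in> F \<Longrightarrow> cinner z f = 0) \<Longrightarrow> inner a (quad A z) \<le> b * (norm z)\<^sup>2"
  obtains \<delta> where "\<delta> \<longlonglongrightarrow> (0::real)" "\<And>n. inner a (quad A (y n)) \<le> b * (norm (y n))\<^sup>2 + \<delta> n"
proof -
  obtain G where G: "finite G" "orthonormal_on G (\<lambda>x. x)" "F \<subseteq> cspan G"
    using orthonormal_set_extend[OF F] .
  define q where "q n = (\<Sum>g\<in>G. cinner (y n) g *\<^sub>C g)" for n
  define c where "c n = (\<chi> j. cinner (A j (q n)) (y n) + cnj (cinner (A j (q n)) (y n)) - cinner (A j (q n)) (q n))" for n
  have q0: "q \<longlonglongrightarrow> 0"
  proof -
    have "(\<lambda>n. cinner (y n) g *\<^sub>C g) \<longlonglongrightarrow> 0 *\<^sub>C g" for g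
      by (rule bounded_linear.tendsto[OF bounded_linear_scaleC_left weak])
    then have "(\<lambda>n. \<Sum>g\<in>G. cinner (y n) g *\<^sub>C g) \<longlonglongrightarrow> (\<Sum>g\<in>G. 0)"
      by (intro tendsto_sum) simp
    then show ?thesis by (simp add: q_def[abs_def])
  qed
  have "(\<lambda>n. cinner (A j (q n)) (y n)) \<longlonglongrightarrow> 0" for j
  proof -
    \<comment> \<open>No norm bound on \<open>y n\<close> enters: expanding over \<open>G\<close>
      makes every summand a product of two null sequences.\<close>
    have eq: "cinner (A j (q n)) (y n) = (\<Sum>g\<in>G. cinner (y n) g * cnj (cinner (y n) (A j g)))" for n
      by (simp add: q_def A_simps cinner_distribs flip: cinner_commute)
    have "(\<lambda>n. \<Sum>g\<in>G. cinner (y n) g * cnj (cinner (y n) (A j g))) \<longlonglongrightarrow> (\<Sum>g\<in>G. 0 * cnj 0)"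
      by (intro tendsto_sum tendsto_mult tendsto_cnj weak)
    then show ?thesis by (simp add: eq)
  qed
  moreover have "(\<lambda>n. cinner (A j (q n)) (q n)) \<longlonglongrightarrow> 0" for j
    using tendsto_cinner[OF bounded_linear.tendsto[OF bounded_clinearD(1)[OF clinear] q0] q0, of j]
    by (simp add: A_simps)
  ultimately have "(\<lambda>n. cinner (A j (q n)) (y n) + cnj (cinner (A j (q n)) (y n)) - cinner (A j (q n)) (q n)) \<longlonglongrightarrow> 0 + cnj 0 - 0" for j
    by (intro tendsto_add tendsto_diff tendsto_cnj)
  then have c0: "c \<longlonglongrightarrow> 0"
    unfolding c_def by (intro vec_tendstoI) simp
  have quad_eq: "quad A (y n) = quad A (y n - q n) + c n" for n
  proof -
    have "cinner (A j (y n)) (q n) = cnj (cinner (A j (q n)) (y n))" for j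
      using adjoint[of j "y n" "q n"] cinner_commute[of "y n" "A j (q n)"] by simp
    then show ?thesis by (simp add: vec_eq_iff c_def A_simps cinner_distribs)
  qed
  have orth: "cinner (y n - q n) f = 0" if "f \<in> cspan G" for n f
    unfolding q_def by (rule cinner_eq_zero_of_span[OF bessel_orthogonal[OF G(2,1)] that])
  have norm_eq: "(norm (y n))\<^sup>2 = (norm (y n - q n))\<^sup>2 + (norm (q n))\<^sup>2" for n
  proof -
    have "q n \<in> cspan G"
      unfolding q_def by (intro complex_vector.span_sum complex_vector.span_scale complex_vector.span_base)
    then show ?thesis using pythagoras[OF orth, of "q n" n] by simp
  qed
  show ?thesis
  proof
    have "(\<lambda>n. inner a (c n) - b * (norm (q n))\<^sup>2) \<longlonglongrightarrow> inner a 0 - b * (norm (0::'h))\<^sup>2"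
      by (intro tendsto_intros c0 q0)
    then show "(\<lambda>n. inner a (c n) - b * (norm (q n))\<^sup>2) \<longlonglongrightarrow> 0" by simp
    show "inner a (quad A (y n)) \<le> b * (norm (y n))\<^sup>2 + (inner a (c n) - b * (norm (q n))\<^sup>2)" for n
    proof -
      have "inner a (quad A (y n - q n)) \<le> b * (norm (y n - q n))\<^sup>2"
        using orth G(3) by (intro le) blast
      then show ?thesis by (subst quad_eq) (simp add: norm_eq inner_add_right algebra_simps)
    qed
  qed
qed

text \<open>Summing the support bounds over \<open>l\<close> gives
  \<open>inner a \<eta> \<le> b * d\<close> for every half-space strictly containing the essential
  range, so for \<open>d > 0\<close> the point \<eta> divided by \<open>d\<close> cannot be
  separated from it. For \<open>d = 0\<close> all norms vanish in the limit, hence \<eta> is 0 and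
  any \<xi> will do.\<close>

lemma weak_null_limit_in_cone:
  assumes weak: "\<And>l g. l < k \<Longrightarrow> (\<lambda>n. cinner (y l n) g) \<longlonglongrightarrow> 0"
    and d: "(\<lambda>n. \<Sum>l<k. (norm (y l n))\<^sup>2) \<longlonglongrightarrow> d"
    and \<eta>: "(\<lambda>n. \<Sum>l<k. quad A (y l n)) \<longlonglongrightarrow> \<eta>"
  shows "\<exists>\<xi>\<in>ess_range A. \<eta> = d *\<^sub>R \<xi>"
proof -
  have "d \<ge> 0" by (rule LIMSEQ_le_const[OF d]) (simp add: sum_nonneg)
  have support: "inner a \<eta> \<le> b * d" if ab: "\<And>\<xi>. \<xi> \<in> ess_range A \<Longrightarrow> inner a \<xi> < b" for a b
  proof -
    obtain F where F: "finite F" "\<And>z. (\<And>f. f \<in> F \<Longrightarrow> cinner z f = 0) \<Longrightarrow> inner a (quad A z) \<le> b * (norm z)\<^sup>2"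
      using ess_range_support[OF ab] by blast
    have "\<forall>l. \<exists>\<delta>. l < k \<longrightarrow> (\<delta> \<longlonglongrightarrow> (0::real) \<and> (\<forall>n. inner a (quad A (y l n)) \<le> b * (norm (y l n))\<^sup>2 + \<delta> n))"
      using tendsto_weak_null_support[OF weak F] by metis
    then obtain \<delta> where \<delta>: "\<And>l. l < k \<Longrightarrow> \<delta> l \<longlonglongrightarrow> (0::real)"
        "\<And>l n. l < k \<Longrightarrow> inner a (quad A (y l n)) \<le> b * (norm (y l n))\<^sup>2 + \<delta> l n"
      by metis
    have "(\<lambda>n. inner a (\<Sum>l<k. quad A (y l n))) \<longlonglongrightarrow> inner a \<eta>"
      by (intro tendsto_intros \<eta>)
    moreover have "(\<lambda>n. b * (\<Sum>l<k. (norm (y l n))\<^sup>2) + (\<Sum>l<k. \<delta> l n)) \<longlonglongrightarrow> b * d + (\<Sum>l<k. 0)"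
      using \<delta>(1) by (intro tendsto_add tendsto_mult tendsto_const d tendsto_sum) auto
    moreover have "inner a (\<Sum>l<k. quad A (y l n)) \<le> b * (\<Sum>l<k. (norm (y l n))\<^sup>2) + (\<Sum>l<k. \<delta> l n)" for n
      unfolding inner_sum_right sum_distrib_left sum.distrib[symmetric] using \<delta>(2) by (intro sum_mono) simp
    ultimately show ?thesis by (simp add: LIMSEQ_le)
  qed
  show ?thesis
  proof (cases "d = 0")
    case True
    obtain M where M: "\<And>x. norm (quad A x) \<le> M * (norm x)\<^sup>2" using norm_quad_le by blast
    have "(\<lambda>n. \<Sum>l<k. quad A (y l n)) \<longlonglongrightarrow> 0"
    proof (rule tendsto_0_le)
      show "(\<lambda>n. \<Sum>l<k. (norm (y l n))\<^sup>2) \<longlonglongrightarrow> 0" using d True by simp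
      have "norm (\<Sum>l<k. quad A (y l n)) \<le> (\<Sum>l<k. M * (norm (y l n))\<^sup>2)" for n
        by (intro order_trans[OF norm_sum] sum_mono M)
      then show "\<forall>\<^sub>F n in sequentially. norm (\<Sum>l<k. quad A (y l n)) \<le> norm (\<Sum>l<k. (norm (y l n))\<^sup>2) * M"
        by (intro always_eventually allI) (simp add: sum_nonneg sum_distrib_left mult.commute)
    qed
    then have "\<eta> = 0" using \<eta> LIMSEQ_unique by blast
    then show ?thesis using True ess_range_nonempty by auto
  next
    case False
    with \<open>d \<ge> 0\<close> have "d > 0" by simp
    have "(1 / d) *\<^sub>R \<eta> \<in> ess_range A"
    proof (rule ccontr)
      assume "(1 / d) *\<^sub>R \<eta> \<notin> ess_range A"
      then obtain a b where "inner a ((1 / d) *\<^sub>R \<eta>) < b" "\<And>\<zeta>. \<zeta> \<in> ess_range A \<Longrightarrow> inner a \<zeta> > b"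
        using separating_hyperplane_closed_point[OF convex_ess_range closed_ess_range] by metis
      moreover from this(2) have "inner (- a) \<eta> \<le> (- b) * d" by (intro support) simp
      ultimately show False using \<open>d > 0\<close> by (simp add: field_simps)
    qed
    then show ?thesis using \<open>d > 0\<close> by (intro bexI[of _ "(1 / d) *\<^sub>R \<eta>"]) auto
  qed
qed

lemma closure_subset_compression_range: "closure (joint_num_range k A) \<subseteq> compression_range k A"
proof
  fix p assume "p \<in> closure (joint_num_range k A)"
  then obtain P where P: "\<And>n. P n \<in> joint_num_range k A" "P \<longlonglongrightarrow> p"
    unfolding closure_sequential by blast
  then have "\<forall>n. \<exists>x. orthonormal_on {..<k} x \<and> P n = (\<Sum>l<k. quad A (x l))"
    unfolding joint_num_range_quad by blast
  then obtain x where x: "\<And>n. orthonormal_on {..<k} (x n)" "\<And>n. P n = (\<Sum>l<k. quad A (x n l))"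
    by metis
  have norm_x: "norm (x n l) = 1" if "l < k" for n l
    using x(1)[of n] that by (simp add: orthonormal_on_def flip: cinner_self_eq_one)
  obtain r u where r: "strict_mono r"
    and wk: "\<And>l y. l < k \<Longrightarrow> (\<lambda>n. inner (x (r n) l) y) \<longlonglongrightarrow> inner (u l) y"
    using bounded_imp_weakly_convergent_subseq_family[of k "\<lambda>l n. x n l" 1] norm_x by auto
  have weak: "(\<lambda>n. cinner (x (r n) l) y) \<longlonglongrightarrow> cinner (u l) y" if "l < k" for l y
    using wk[OF that] by (rule tendsto_cinner_weak)
  have u: "contractive_family k u"
    unfolding contractive_family_def
  proof
    fix a :: "nat \<Rightarrow> complex"
    define w where "w = (\<Sum>l<k. a l *\<^sub>C u l)"
    define z where "z n = (\<Sum>l<k. a l *\<^sub>C x (r n) l)" for n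
    have nz: "(norm (z n))\<^sup>2 = (\<Sum>l<k. (cmod (a l))\<^sup>2)" for n
      unfolding z_def by (rule norm_sum_orthonormal[OF x(1)]) simp
    have "(\<lambda>n. \<Sum>l<k. a l * cinner (x (r n) l) w) \<longlonglongrightarrow> (\<Sum>l<k. a l * cinner (u l) w)"
      by (intro tendsto_sum tendsto_mult tendsto_const weak) simp
    moreover have "(\<Sum>l<k. a l * cinner (u l) w) = cinner w w"
      by (subst (2) w_def) (simp add: cinner_distribs)
    ultimately have "(\<lambda>n. cinner (z n) w) \<longlonglongrightarrow> cinner w w"
      by (simp add: z_def cinner_distribs)
    then have "(\<lambda>n. Re (cinner (z n) w)) \<longlonglongrightarrow> (norm w)\<^sup>2"
      using tendsto_Re by (fastforce simp: cinner_self)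
    \<comment> \<open>Weak lower semicontinuity of the norm without dividing by
      \<open>norm w\<close>: in the limit \<open>(norm w)\<^sup>2\<close> is at most the mean of
      itself and the squared norm of \<open>a\<close>.\<close>
    moreover have "Re (cinner (z n) w) \<le> ((norm (z n))\<^sup>2 + (norm w)\<^sup>2) / 2" for n
      using norm_cauchy_schwarz[of "z n" w] sum_squares_bound[of "norm (z n)" "norm w"]
      by (simp add: Re_cinner)
    ultimately have "(norm w)\<^sup>2 \<le> ((\<Sum>l<k. (cmod (a l))\<^sup>2) + (norm w)\<^sup>2) / 2"
      unfolding nz by (intro LIMSEQ_le_const2) auto
    then show "(norm (\<Sum>l<k. a l *\<^sub>C u l))\<^sup>2 \<le> (\<Sum>l<k. (cmod (a l))\<^sup>2)"
      by (simp add: w_def)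
  qed
  define y where "y l n = x (r n) l - u l" for l n
  define d where "d = real k - (\<Sum>l<k. (norm (u l))\<^sup>2)"
  define \<eta> where "\<eta> = p - (\<Sum>l<k. quad A (u l))"
  have wy: "(\<lambda>n. cinner (y l n) g) \<longlonglongrightarrow> 0" if "l < k" for l g
    using tendsto_diff[OF weak[OF that, of g] tendsto_const[of "cinner (u l) g"]]
    by (simp add: y_def cinner_diff_left)
  \<comment> \<open>Because each \<open>x (r n) l\<close> has norm 1, weak convergence alone forces
    the norms of the remainders to converge.\<close>
  have "(\<lambda>n. \<Sum>l<k. (norm (y l n))\<^sup>2) \<longlonglongrightarrow> (\<Sum>l<k. 1 - (norm (u l))\<^sup>2 - 2 * Re 0)"
  proof (rule tendsto_sum)
    fix l assume "l \<in> {..<k}"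
    then have l: "l < k" by simp
    have "(norm (y l n))\<^sup>2 = 1 - (norm (u l))\<^sup>2 - 2 * Re (cinner (y l n) (u l))" for n
      using norm_add_square[of "y l n" "u l"] norm_x[OF l, of "r n"] by (simp add: y_def)
    moreover have "(\<lambda>n. 1 - (norm (u l))\<^sup>2 - 2 * Re (cinner (y l n) (u l))) \<longlonglongrightarrow> 1 - (norm (u l))\<^sup>2 - 2 * Re 0"
      by (intro tendsto_intros wy[OF l])
    ultimately show "(\<lambda>n. (norm (y l n))\<^sup>2) \<longlonglongrightarrow> 1 - (norm (u l))\<^sup>2 - 2 * Re 0"
      by simp
  qed
  then have dlim: "(\<lambda>n. \<Sum>l<k. (norm (y l n))\<^sup>2) \<longlonglongrightarrow> d"
    by (simp add: d_def sum_subtractf)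
  \<comment> \<open>The cross terms between remainder and weak limit; each is linear or
    conjugate-linear in the weakly null \<open>y l n\<close>.\<close>
  define c where "c l n = (\<chi> j. cinner (y l n) (A j (u l)) + cnj (cinner (y l n) (A j (u l))))" for l n
  have "quad A (y l n) = quad A (x (r n) l) - quad A (u l) - c l n" for l n
  proof -
    have "cinner (A j (y l n)) (u l) = cinner (y l n) (A j (u l))"
      "cinner (A j (u l)) (y l n) = cnj (cinner (y l n) (A j (u l)))" for j
      by (rule adjoint) (rule cinner_commute)
    moreover have "x (r n) l = y l n + u l" by (simp add: y_def)
    ultimately show ?thesis
      by (simp add: vec_eq_iff c_def A_simps cinner_add_left cinner_add_right)
  qed
  then have "(\<Sum>l<k. quad A (y l n)) = P (r n) - (\<Sum>l<k. quad A (u l)) - (\<Sum>l<k. c l n)" for n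
    by (simp add: x(2) sum_subtractf)
  moreover have "(\<lambda>n. P (r n) - (\<Sum>l<k. quad A (u l)) - (\<Sum>l<k. c l n)) \<longlonglongrightarrow> p - (\<Sum>l<k. quad A (u l)) - (\<Sum>l<k. 0)"
  proof (intro tendsto_diff tendsto_const tendsto_sum)
    show "(\<lambda>n. P (r n)) \<longlonglongrightarrow> p" using LIMSEQ_subseq_LIMSEQ[OF P(2) r] by (simp add: o_def)
    fix l assume "l \<in> {..<k}"
    then have "(\<lambda>n. cinner (y l n) (A j (u l)) + cnj (cinner (y l n) (A j (u l)))) \<longlonglongrightarrow> 0 + cnj 0" for j
      by (intro tendsto_add tendsto_cnj wy) auto
    then show "c l \<longlonglongrightarrow> 0" unfolding c_def by (intro vec_tendstoI) simp
  qed
  ultimately have "(\<lambda>n. \<Sum>l<k. quad A (y l n)) \<longlonglongrightarrow> \<eta>"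
    by (simp add: \<eta>_def)
  then obtain \<xi> where "\<xi> \<in> ess_range A" "\<eta> = d *\<^sub>R \<xi>"
    using weak_null_limit_in_cone[OF wy dlim] by blast
  then show "p \<in> compression_range k A"
    unfolding compression_range_def using u
    by (intro CollectI exI[of _ u] exI[of _ \<xi>]) (simp add: \<eta>_def d_def diff_eq_eq add.commute)
qed

lemma closure_joint_num_range: "closure (joint_num_range k A) = compression_range k A"
  using closure_subset_compression_range compression_range_subset_closure by blast

end

section \<open>Diagonal operators\<close>

lemma continuous_on_quad:
  assumes "\<And>j. bounded_clinear (D j)"
  shows "continuous_on S (quad D)"
  unfolding quad_def
  by (intro continuous_on_vec_lambda continuous_on_cinner continuous_on_id
      linear_continuous_on bounded_clinearD(1) assms)

lemma quad_diagonal: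
  assumes "\<And>j. bounded_clinear (D j)" "\<And>j. D j v = (\<mu> $ j) *\<^sub>C v"
  shows "quad D (c *\<^sub>C v) = (cmod c * norm v)\<^sup>2 *\<^sub>R \<mu>"
proof -
  have "cinner (D j (c *\<^sub>C v)) (c *\<^sub>C v) = (c * cnj c) * cinner v v * \<mu> $ j" for j
    by (simp add: bounded_clinearD(2)[OF assms(1)] assms(2) cinner_distribs)
  then show ?thesis
    by (simp add: vec_eq_iff mult_cnj_self cinner_self)
      (simp add: scaleR_conv_of_real power_mult_distrib)
qed

text \<open>On finite combinations of basis vectors the forms give nonnegative combinations of
  points of \<open>W\<close>, with total weight the squared norm. A half-space bound is a closed
  condition, so density extends it to every vector; separating the sum over all of \<open>I\<close>
  then yields a single \<xi>.\<close>

lemma diagonal_quad_in_cone: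
  fixes e :: "complex ^ 'm::finite \<Rightarrow> 'h::complex_inner"
  assumes W: "convex W" "closed W" "W \<noteq> {}"
    and e: "orthonormal_basis_on W e"
    and D: "\<And>j. bounded_clinear (D j)" "\<And>j \<mu>. \<mu> \<in> W \<Longrightarrow> D j (e \<mu>) = (\<mu> $ j) *\<^sub>C e \<mu>"
    and I: "finite I"
  shows "\<exists>\<xi>\<in>W. (\<Sum>i\<in>I. quad D (w i)) = (\<Sum>i\<in>I. (norm (w i))\<^sup>2) *\<^sub>R \<xi>"
proof -
  have bound: "b * (norm v)\<^sup>2 \<le> inner a (quad D v)" if ab: "\<And>\<xi>. \<xi> \<in> W \<Longrightarrow> inner a \<xi> > b" for a b v
  proof -
    have cont: "continuous_on UNIV (\<lambda>v. inner a (quad D v))"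
      by (intro continuous_intros continuous_on_quad D)
    have "closed {v. b * (norm v)\<^sup>2 \<le> inner a (quad D v)}"
      by (intro closed_Collect_le cont continuous_intros)
    moreover have "cspan (e ` W) \<subseteq> {v. b * (norm v)\<^sup>2 \<le> inner a (quad D v)}"
    proof
      fix v assume "v \<in> cspan (e ` W)"
      then obtain F where F: "finite F" "F \<subseteq> W" "v \<in> cspan (e ` F)"
        using cspan_image_finite_subset by blast
      have on: "orthonormal_on F e"
        using e F(2) orthonormal_on_subset unfolding orthonormal_basis_on_def by blast
      define c where "c \<mu> = cinner v (e \<mu>)" for \<mu>
      have v: "v = (\<Sum>\<mu>\<in>F. c \<mu> *\<^sub>C e \<mu>)"
        unfolding c_def by (rule orthonormal_family_expansion[OF F(1) on F(3)])
      have nv: "(norm v)\<^sup>2 = (\<Sum>\<mu>\<in>F. (cmod (c \<mu>))\<^sup>2)"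
        by (subst v) (rule norm_sum_orthonormal[OF on F(1)])
      have "cinner (D j v) v = (\<Sum>\<mu>\<in>F. of_real ((cmod (c \<mu>))\<^sup>2) * \<mu> $ j)" for j
      proof -
        have "D j v = (\<Sum>\<mu>\<in>F. (c \<mu> * \<mu> $ j) *\<^sub>C e \<mu>)"
          by (subst v) (use D(2) F(2) in \<open>auto simp: bounded_clinear_simps[OF D(1)] bounded_clinearD(2)[OF D(1)] intro!: sum.cong\<close>)
        then have "cinner (D j v) v = (\<Sum>\<mu>\<in>F. (c \<mu> * \<mu> $ j) * cnj (c \<mu>))"
          by (simp add: cinner_sum_left cinner_scaleC_left c_def flip: cinner_commute)
        also have "\<dots> = (\<Sum>\<mu>\<in>F. (c \<mu> * cnj (c \<mu>)) * \<mu> $ j)" by (simp add: ac_simps)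
        finally show ?thesis by (simp add: mult_cnj_self)
      qed
      then have "quad D v = (\<Sum>\<mu>\<in>F. (cmod (c \<mu>))\<^sup>2 *\<^sub>R \<mu>)"
        by (simp add: vec_eq_iff) (simp add: scaleR_conv_of_real)
      moreover have "(\<Sum>\<mu>\<in>F. (cmod (c \<mu>))\<^sup>2 * b) \<le> (\<Sum>\<mu>\<in>F. (cmod (c \<mu>))\<^sup>2 * inner a \<mu>)"
        using ab F(2) by (intro sum_mono) (auto intro!: mult_left_mono intro: less_imp_le)
      ultimately show "v \<in> {v. b * (norm v)\<^sup>2 \<le> inner a (quad D v)}"
        by (simp add: nv inner_sum_right sum_distrib_left mult.commute)
    qed
    ultimately have "closure (cspan (e ` W)) \<subseteq> {v. b * (norm v)\<^sup>2 \<le> inner a (quad D v)}"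
      by (intro closure_minimal)
    then show ?thesis using e by (auto simp: orthonormal_basis_on_def)
  qed
  define s where "s = (\<Sum>i\<in>I. (norm (w i))\<^sup>2)"
  have "s \<ge> 0" unfolding s_def by (simp add: sum_nonneg)
  show ?thesis
  proof (cases "s = 0")
    case True
    then have "w i = 0" if "i \<in> I" for i
      using that I by (simp add: s_def sum_nonneg_eq_0_iff)
    then have "quad D (w i) = 0" if "i \<in> I" for i
      using that by (simp add: vec_eq_iff bounded_clinear_simps[OF D(1)])
    then show ?thesis using W(3) True by (auto simp: s_def)
  next
    case False
    with \<open>s \<ge> 0\<close> have "s > 0" by simp
    have "(1 / s) *\<^sub>R (\<Sum>i\<in>I. quad D (w i)) \<in> W"
    proof (rule ccontr)
      assume "(1 / s) *\<^sub>R (\<Sum>i\<in>I. quad D (w i)) \<notin> W"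
      then obtain a b where ab: "inner a ((1 / s) *\<^sub>R (\<Sum>i\<in>I. quad D (w i))) < b" "\<And>\<xi>. \<xi> \<in> W \<Longrightarrow> inner a \<xi> > b"
        using separating_hyperplane_closed_point[OF W(1,2)] by metis
      have "b * s \<le> inner a (\<Sum>i\<in>I. quad D (w i))"
        unfolding s_def sum_distrib_left inner_sum_right using bound[OF ab(2)] by (intro sum_mono)
      then show False using ab(1) \<open>s > 0\<close> by (simp add: field_simps)
    qed
    then show ?thesis
      using \<open>s > 0\<close> by (intro bexI[of _ "(1 / s) *\<^sub>R (\<Sum>i\<in>I. quad D (w i))"]) (auto simp: s_def)
  qed
qed

section \<open>Forms on direct sums and the final identification\<close>

lemma quad_map_prod: "quad (\<lambda>j. map_prod (A j) (B j)) x = quad A (fst x) + quad B (snd x)"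
  by (simp add: vec_eq_iff cinner_prod_def)

lemma quad_ampliation: "quad (\<lambda>j. ampliation (D j)) v = (\<Sum>i\<in>UNIV. quad D (v $ i))"
  by (simp add: vec_eq_iff cinner_vec_def ampliation_def)

lemma norm_vec_square: "(norm (v :: 'a::real_normed_vector ^ 'n))\<^sup>2 = (\<Sum>i\<in>UNIV. (norm (v $ i))\<^sup>2)"
  by (simp add: norm_vec_def L2_set_def sum_nonneg)

lemma of_nat_vector_scaleC: "of_nat n *s x = real n *\<^sub>R (x :: complex ^ 'm)"
  by (simp add: vec_eq_iff) (simp add: scaleR_conv_of_real)

lemma contractive_family_fst:
  assumes "orthonormal_on {..<k} x"
  shows "contractive_family k (\<lambda>l. fst (x l))"
  unfolding contractive_family_def
proof
  fix a :: "nat \<Rightarrow> complex"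
  have "(\<Sum>l<k. a l *\<^sub>C fst (x l)) = fst (\<Sum>l<k. a l *\<^sub>C x l)"
    by (simp add: fst_sum scaleC_prod_def)
  then have "(norm (\<Sum>l<k. a l *\<^sub>C fst (x l)))\<^sup>2 \<le> (norm (\<Sum>l<k. a l *\<^sub>C x l))\<^sup>2"
    using norm_fst_le[of "fst (\<Sum>l<k. a l *\<^sub>C x l)" "snd (\<Sum>l<k. a l *\<^sub>C x l)"]
    by (intro power_mono) auto
  then show "(norm (\<Sum>l<k. a l *\<^sub>C fst (x l)))\<^sup>2 \<le> (\<Sum>l<k. (cmod (a l))\<^sup>2)"
    using norm_sum_orthonormal[OF assms] by simp
qed

theorem theorem4p3:
  fixes A :: "'m::finite \<Rightarrow> 'h::complex_hilbert \<Rightarrow> 'h"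
    and e :: "complex ^ 'm \<Rightarrow> 'h1::complex_hilbert"
    and D :: "'m \<Rightarrow> 'h1 \<Rightarrow> 'h1"
    and ID :: "'m \<Rightarrow> 'h1 ^ 'k::finite \<Rightarrow> 'h1 ^ 'k"
    and At :: "'m \<Rightarrow> 'h \<times> ('h1 ^ 'k) \<Rightarrow> 'h \<times> ('h1 ^ 'k)"
    and k :: nat
  assumes "infinite_dimensional TYPE('h)"
    and "k > 0" and "CARD('k) = k"
    and "\<And>j. selfadjoint (A j)"
    and "orthonormal_basis_on (joint_ess_num_range A) e"
    and "\<And>j. bounded_clinear (D j)"
    and "\<And>j \<mu>. \<mu> \<in> joint_ess_num_range A \<Longrightarrow> D j (e \<mu>) = (\<mu> $ j) *\<^sub>C e \<mu>"
    and "\<And>j. ID j = ampliation (D j)"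
    and "\<And>j. At j = map_prod (A j) (ID j)"
  shows "(\<forall>l\<in>{1..k}. joint_num_range l ID = (\<lambda>\<mu>. of_nat l *s \<mu>) ` joint_ess_num_range A) \<and>
    closure (joint_num_range k A) = joint_num_range k At \<and>
    (closed (joint_num_range k A) \<longleftrightarrow> joint_num_range k A = joint_num_range k At) \<and>
    (joint_num_range k A = joint_num_range k At \<longleftrightarrow>
      joint_num_range k A =
        {(\<chi> j. op_trace (\<lambda>x. A j (P x))) + (of_nat k - op_trace P) *s \<xi> | P \<xi>.
          positive_semidefinite P \<and> contraction P \<and> rank_at_most k P \<and>
          \<xi> \<in> joint_ess_num_range A})"
proof -
  interpret selfadjoint_tuple A
    by standard (rule assms)+
  let ?W = "ess_range A"
  have W: "joint_ess_num_range A = ?W" by (rule joint_ess_num_range_eq)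
  note e = assms(5)[unfolded W] and D = assms(6) assms(7)[unfolded W]
  have norm_e: "norm (e \<mu>) = 1" if "\<mu> \<in> ?W" for \<mu>
    using e that by (simp add: orthonormal_basis_on_def orthonormal_on_def flip: cinner_self_eq_one)
  have ID: "ID = (\<lambda>j. ampliation (D j))" and At: "At = (\<lambda>j. map_prod (A j) (ID j))"
    using assms by auto
  have quad_ID: "quad ID v = (\<Sum>i\<in>UNIV. quad D (v $ i))" for v
    unfolding ID by (rule quad_ampliation)
  have quad_At: "quad At x = quad A (fst x) + quad ID (snd x)" for x
    unfolding At by (rule quad_map_prod)
  \<comment> \<open>Numbering the copies by \<open>{..<k}\<close> lets copy \<open>i\<close> carry
    column \<open>h i\<close> of a matrix \<open>V\<close>.\<close>
  obtain h :: "'k \<Rightarrow> nat" where h: "bij_betw h UNIV {..<k}"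
    using finite_same_card_bij[of "UNIV :: 'k set" "{..<k}"] assms(3) by auto
  \<comment> \<open>All components of all \<open>v l\<close> are treated as one finite family, so
    one \<xi> serves every \<open>l\<close> and every copy.\<close>
  have cone: "\<exists>\<xi>\<in>?W. (\<Sum>l<n. quad ID (v l)) = (\<Sum>l<n. (norm (v l))\<^sup>2) *\<^sub>R \<xi>"
    for n and v :: "nat \<Rightarrow> 'h1 ^ 'k"
    using diagonal_quad_in_cone[OF convex_ess_range closed_ess_range ess_range_nonempty e D,
        of "{..<n} \<times> UNIV" "\<lambda>(l, i). v l $ i"]
    by (simp add: quad_ID norm_vec_square sum.cartesian_product case_prod_beta)
  have quad_e: "quad ID (\<chi> i. f i *\<^sub>C e \<mu>) = (\<Sum>i\<in>UNIV. (cmod (f i))\<^sup>2) *\<^sub>R \<mu>" if "\<mu> \<in> ?W" for f \<mu>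
    using that by (simp add: quad_ID quad_diagonal[OF D(1) D(2)] norm_e scaleR_sum_left)
  have cinner_e: "cinner (\<chi> i. f i *\<^sub>C e \<mu>) (\<chi> i::'k. g i *\<^sub>C e \<mu>) = (\<Sum>i\<in>UNIV. f i * cnj (g i))" if "\<mu> \<in> ?W" for f g \<mu>
    using that by (simp add: cinner_vec_def cinner_distribs cinner_self norm_e mult.commute)
  have reindex: "(\<Sum>i\<in>UNIV. g (h i)) = (\<Sum>c<k. g c)" for g :: "nat \<Rightarrow> 'b::comm_monoid_add"
    using h by (rule sum.reindex_bij_betw)

  have part1: "joint_num_range l ID = (\<lambda>\<mu>. of_nat l *s \<mu>) ` ?W" if "l \<in> {1..k}" for l
  proof (intro subset_antisym subsetI)
    fix p assume "p \<in> joint_num_range l ID"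
    then obtain v where v: "orthonormal_on {..<l} v" "p = (\<Sum>m<l. quad ID (v m))"
      unfolding joint_num_range_quad by blast
    then have "norm (v m) = 1" if "m < l" for m
      using that by (simp add: orthonormal_on_def flip: cinner_self_eq_one)
    then have "(\<Sum>m<l. (norm (v m))\<^sup>2) = real l" by simp
    then show "p \<in> (\<lambda>\<mu>. of_nat l *s \<mu>) ` ?W"
      using cone[where n = l and v = v] v(2) by (auto simp: of_nat_vector_scaleC)
  next
    fix p assume "p \<in> (\<lambda>\<mu>. of_nat l *s \<mu>) ` ?W"
    then obtain \<mu> where \<mu>: "\<mu> \<in> ?W" "p = real l *\<^sub>R \<mu>" by (auto simp: of_nat_vector_scaleC)
    \<comment> \<open>The vector \<open>e \<mu>\<close> placed in copy number \<open>m\<close>;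
      \<open>l \<le> k\<close> ensures that there are enough copies.\<close>
    define v :: "nat \<Rightarrow> 'h1 ^ 'k" where "v m = (\<chi> i. (if h i = m then 1 else 0) *\<^sub>C e \<mu>)" for m
    have "cinner (v m) (v n) = (if m = n then 1 else 0)" if "m < l" "n < l" for m n
    proof -
      have "cinner (v m) (v n) = (\<Sum>c<k. (if c = m then 1 else 0) * cnj (if c = n then 1 else 0))"
        unfolding v_def cinner_e[OF \<mu>(1)] by (rule reindex)
      also have "\<dots> = (\<Sum>c<k. if c = m then (if m = n then 1 else 0) else 0)"
        by (intro sum.cong) auto
      finally show ?thesis using that \<open>l \<in> {1..k}\<close> by simp
    qed
    then have "orthonormal_on {..<l} v" by (simp add: orthonormal_on_def)
    moreover have "quad ID (v m) = \<mu>" if "m < l" for m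
    proof -
      have "quad ID (v m) = (\<Sum>c<k. (cmod (if c = m then 1 else 0))\<^sup>2) *\<^sub>R \<mu>"
        unfolding v_def quad_e[OF \<mu>(1)] by (subst reindex) simp
      also have "(\<Sum>c<k. (cmod (if c = m then 1 else 0))\<^sup>2) = (\<Sum>c<k. if c = m then 1 else 0)"
        by (intro sum.cong) auto
      finally show ?thesis using that \<open>l \<in> {1..k}\<close> by simp
    qed
    then have "p = (\<Sum>m<l. quad ID (v m))" by (simp add: \<mu>(2) sum_constant_scaleR del: sum_constant)
    ultimately show "p \<in> joint_num_range l ID"
      unfolding joint_num_range_quad by blast
  qed

  have part2: "joint_num_range k At = compression_range k A"
  proof (intro subset_antisym subsetI)
    fix p assume "p \<in> joint_num_range k At"
    then obtain x where x: "orthonormal_on {..<k} x" "p = (\<Sum>l<k. quad At (x l))"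
      unfolding joint_num_range_quad by blast
    obtain \<xi> where \<xi>: "\<xi> \<in> ?W" "(\<Sum>l<k. quad ID (snd (x l))) = (\<Sum>l<k. (norm (snd (x l)))\<^sup>2) *\<^sub>R \<xi>"
      using cone[where n = k and v = "\<lambda>l. snd (x l)"] by blast
    have "(norm (snd (x l)))\<^sup>2 = 1 - (norm (fst (x l)))\<^sup>2" if "l < k" for l
    proof -
      have "norm (x l) = 1"
        using x(1) that by (simp add: orthonormal_on_def flip: cinner_self_eq_one)
      then show ?thesis by (simp add: norm_prod_def)
    qed
    then have "(\<Sum>l<k. (norm (snd (x l)))\<^sup>2) = real k - (\<Sum>l<k. (norm (fst (x l)))\<^sup>2)"
      by (simp add: sum_subtractf)
    then have "p = (\<Sum>l<k. quad A (fst (x l))) + (real k - (\<Sum>l<k. (norm (fst (x l)))\<^sup>2)) *\<^sub>R \<xi>"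
      using \<xi>(2) by (simp add: x(2) quad_At sum.distrib)
    then show "p \<in> compression_range k A"
      unfolding compression_range_def using contractive_family_fst[OF x(1)] \<xi>(1)
      by (intro CollectI exI[of _ "\<lambda>l. fst (x l)"] exI[of _ \<xi>] conjI)
  next
    fix p assume "p \<in> compression_range k A"
    then obtain u \<xi> where p: "p = (\<Sum>l<k. quad A (u l)) + (real k - (\<Sum>l<k. (norm (u l))\<^sup>2)) *\<^sub>R \<xi>"
        and u: "contractive_family k u" and \<xi>: "\<xi> \<in> ?W"
      unfolding compression_range_def by blast
    obtain f :: "nat \<Rightarrow> 'h" where f: "orthonormal_on {..<k} f" using orthonormal_family_exists .
    obtain V where V: "\<And>l m. l < k \<Longrightarrow> m < k \<Longrightarrow>
        cinner (u l) (u m) + (\<Sum>c<k. V l c * cnj (V m c)) = (if l = m then 1 else 0)"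
      using contractive_family_defect[OF u f] by blast
    have Vsum: "(\<Sum>l<k. \<Sum>c<k. (cmod (V l c))\<^sup>2) = real k - (\<Sum>l<k. (norm (u l))\<^sup>2)"
      using V by (rule defect_norm_sum)
    \<comment> \<open>Row \<open>l\<close> of \<open>V\<close> spread over the copies of the single
      vector \<open>e \<xi>\<close>: the Gram matrix of \<open>v\<close> is the defect of
      \<open>u\<close>, and every value is an exact multiple of \<xi>.\<close>
    define v :: "nat \<Rightarrow> 'h1 ^ 'k" where "v l = (\<chi> i. V l (h i) *\<^sub>C e \<xi>)" for l
    have "cinner (v l) (v m) = (\<Sum>c<k. V l c * cnj (V m c))" for l m
      unfolding v_def cinner_e[OF \<xi>] by (rule reindex)
    then have "orthonormal_on {..<k} (\<lambda>l. (u l, v l))"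
      using V by (simp add: orthonormal_on_def cinner_prod_def)
    moreover have "quad ID (v l) = (\<Sum>c<k. (cmod (V l c))\<^sup>2) *\<^sub>R \<xi>" for l
      unfolding v_def quad_e[OF \<xi>] by (subst reindex) simp
    then have "p = (\<Sum>l<k. quad At (u l, v l))"
      by (simp add: p quad_At sum.distrib Vsum flip: scaleR_sum_left)
    ultimately show "p \<in> joint_num_range k At"
      unfolding joint_num_range_quad by (intro CollectI exI[of _ "\<lambda>l. (u l, v l)"] conjI)
  qed
  have part3: "closure (joint_num_range k A) = joint_num_range k At"
    by (simp add: closure_joint_num_range part2)
  then have "closed (joint_num_range k A) \<longleftrightarrow> joint_num_range k A = joint_num_range k At"
    by (metis closure_eq)
  then show ?thesis
    using part1 part3 compression_range_trace[of k] unfolding W part2 by simp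
qed

end
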